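(* Let $N\ge 2$ be an even integer, let $\Sigma_N=\bigcup_{l=0}^{N-1}\{te^{i\pi l/N}:t\in\mathbb R\}\subset\mathbb C$ be the Coxeter system of $N$ lines, and let $1\le q\le 2$. Then $\Sigma_N$ is a set of injectivity for the twisted spherical means for $L^q(\mathbb C)$; that is, if $f\in L^q(\mathbb C)$ satisfies $f\times\mu_r(z)=0$ for all $r>0$ and all $z\in\Sigma_N$, then $f=0$ almost everywhere.
   Context: $L^q(\mathbb C)$ is taken with respect to Lebesgue measure. For $r>0$, $\mu_r$ is the normalized arc-length measure on the circle $\{w\in\mathbb C:|w|=r\}$, and the twisted spherical mean of $f$ is $$f\times\mu_r(z)=\int_{|w|=r} f(z-w)\,e^{\frac i2\operatorname{Im}(z\bar w)}\,d\mu_r(w).$$ *)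

theory Defs
  imports "HOL-Analysis.Analysis"
begin

definition Lq :: "real \<Rightarrow> (complex \<Rightarrow> complex) set" where
  "Lq q = {f \<in> borel_measurable lebesgue. integrable lebesgue (\<lambda>z. norm (f z) powr q)}"

(* The completion makes a Lebesgue measurable f measurable, up to a null set of radii, on the
   circles around a given centre. With the Borel measure alone, a function altered on a planar
   null set could fail to be measurable on every circle, and its Bochner integrals would all
   be 0 by convention. *)
definition circle_measure :: "real \<Rightarrow> complex measure" where
  "circle_measure r =
     completion (distr (uniform_measure lborel {0..<2 * pi}) borel (\<lambda>t. of_real r * cis t))"

definition twisted_mean :: "(complex \<Rightarrow> complex) \<Rightarrow> real \<Rightarrow> complex \<Rightarrow> complex" where
  "twisted_mean f r z =
     (LINT w|circle_measure r. f (z - w) * exp (\<i> / 2 * of_real (Im (z * cnj w))))"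

definition coxeter_system :: "nat \<Rightarrow> complex set" where
  "coxeter_system N =
     (\<Union>l\<in>{0..<N}. {of_real t * exp (\<i> * of_real (pi * real l / real N)) | t :: real. True})"

(* A circle on which f is not integrable gives the value 0 of the Bochner integral, so it
   imposes no condition. For locally integrable f and a fixed centre this concerns only a
   null set of radii. *)
definition injectivity_set :: "complex set \<Rightarrow> (complex \<Rightarrow> complex) set \<Rightarrow> bool" where
  "injectivity_set S F \<longleftrightarrow>
     (\<forall>f\<in>F. (\<forall>r>0. \<forall>z\<in>S. twisted_mean f r z = 0) \<longrightarrow> (AE z in lebesgue. f z = 0))"

end

(* Since N is even, the system contains both coordinate axes, and these alone suffice.
   Averaging over rotations turns the vanishing circle means at a point x \<zeta> (\<zeta> = 1 or \<i>) into
     \<integral> f(w) exp(x (c cnj(\<zeta>) w + d \<zeta> cnj(w))) exp(-a |w|^2) dw = 0,  c = a + 1/4, d = a - 1/4,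
   for all a > 0 and real x. Comparing coefficients of x^n for the two axes, the sums
     \<Sum> (n choose l) c^(n-l) d^l M(n-l, l)
   over even l and over odd l vanish separately, where M(j, l) is the moment
   \<integral> f(w) w^j cnj(w)^l exp(-a |w|^2) dw. Induction on p = |j - l| shows that all moments vanish for
   a > 1/4, where c and d are nonzero: d/da M(j, l) = - M(j+1, l+1) reduces the claim to M(p, 0)
   and M(0, p). For odd p these are isolated in the two sums with n = p. For even p, n = p gives
   c^p M(p, 0) + d^p M(0, p) = 0; its derivative in a, combined with the odd sum for n = p + 2,
   gives the same relation with exponent p - 1, and c \<noteq> d finishes the induction. Finally f is
   recovered from its Gaussian moments. The argument only uses that f is integrable against
   every Gaussian. *)
theory Submission
  imports
    Defs
    "HOL-Probability.Distributions"
    "HOL-Complex_Analysis.Cauchy_Integral_Formula"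
    "HOL-Real_Asymp.Real_Asymp"
begin

subsection \<open>Rotation averages\<close>

lemma lborel_complex: "distr (lborel \<Otimes>\<^sub>M lborel) borel (\<lambda>(x, y). Complex x y) = (lborel :: complex measure)"
proof (rule lborel_eqI[symmetric])
  have meas[measurable]: "(\<lambda>(x, y). Complex x y) \<in> borel_measurable (lborel \<Otimes>\<^sub>M (lborel::real measure))"
    unfolding Complex_eq by measurable
  fix l u :: complex
  assume le: "\<And>b. b \<in> Basis \<Longrightarrow> l \<bullet> b \<le> u \<bullet> b"
  have "(\<lambda>(x, y). Complex x y) -` box l u = {Re l<..<Re u} \<times> {Im l<..<Im u}"
    by (auto simp: box_def Basis_complex_def)
  moreover have "Re l \<le> Re u" "Im l \<le> Im u"
    using le[of 1] le[of \<i>] by (auto simp: Basis_complex_def)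
  ultimately show "emeasure (distr (lborel \<Otimes>\<^sub>M lborel) borel (\<lambda>(x, y). Complex x y)) (box l u) = (\<Prod>b\<in>Basis. (u - l) \<bullet> b)"
    by (simp add: emeasure_distr space_pair_measure lborel.emeasure_pair_measure_Times Basis_complex_def ennreal_mult)
qed simp

lemma nn_integral_lborel_complex:
  fixes F :: "complex \<Rightarrow> ennreal"
  assumes [measurable]: "F \<in> borel_measurable borel"
  shows "(\<integral>\<^sup>+w. F w \<partial>lborel) = (\<integral>\<^sup>+x. \<integral>\<^sup>+y. F (Complex x y) \<partial>lborel \<partial>lborel)"
proof -
  have [measurable]: "(\<lambda>(x, y). Complex x y) \<in> borel_measurable (lborel \<Otimes>\<^sub>M (lborel::real measure))"
    unfolding Complex_eq by measurable
  have "(\<integral>\<^sup>+w. F w \<partial>lborel) = (\<integral>\<^sup>+w. F (case w of (x, y) \<Rightarrow> Complex x y) \<partial>(lborel \<Otimes>\<^sub>M lborel))"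
    by (subst lborel_complex[symmetric]) (simp add: nn_integral_distr)
  also have "\<dots> = (\<integral>\<^sup>+x. \<integral>\<^sup>+y. F (Complex x y) \<partial>lborel \<partial>lborel)"
    by (subst lborel.nn_integral_fst[symmetric]) auto
  finally show ?thesis .
qed

text \<open>Shear decomposition: for fixed \<open>y\<close> the first coordinate becomes the new
  \<open>x\<close>, which turns the second into \<open>(s / c) * x + (1 / c) * y\<close>; after
  Fubini, an affine substitution in \<open>y\<close> for fixed \<open>x\<close> absorbs the Jacobian
  \<open>1 / c\<close>. This needs \<open>c\<close> nonzero.\<close>

lemma nn_integral_rotate_aux:
  fixes F :: "complex \<Rightarrow> ennreal"
  assumes [measurable]: "F \<in> borel_measurable borel" and u: "norm u = 1" "Re u \<noteq> 0"
  shows "(\<integral>\<^sup>+w. F (u * w) \<partial>lborel) = (\<integral>\<^sup>+w. F w \<partial>lborel)"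
proof -
  define c s where "c = Re u" and "s = Im u"
  have c: "c \<noteq> 0" and cs: "c * c + s * s = 1"
    using u by (auto simp: c_def s_def cmod_def power2_eq_square)
  have [measurable]: "(\<lambda>p. F (Complex (g p) (h p))) \<in> borel_measurable M"
    if [measurable]: "g \<in> borel_measurable M" "h \<in> borel_measurable M" for g h and M :: "'b measure"
    unfolding Complex_eq by measurable
  have mult: "u * Complex x y = Complex (c * x - s * y) (s * x + c * y)" for x y
    by (simp add: complex_eq_iff c_def s_def)
  have "(\<integral>\<^sup>+w. F (u * w) \<partial>lborel) = (\<integral>\<^sup>+x. \<integral>\<^sup>+y. F (Complex (c * x - s * y) (s * x + c * y)) \<partial>lborel \<partial>lborel)"
    by (simp add: nn_integral_lborel_complex mult)
  also have "\<dots> = (\<integral>\<^sup>+y. \<integral>\<^sup>+x. F (Complex (c * x - s * y) (s * x + c * y)) \<partial>lborel \<partial>lborel)"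
    by (rule lborel_pair.Fubini') measurable
  also have "\<dots> = (\<integral>\<^sup>+y. ennreal \<bar>1 / c\<bar> * (\<integral>\<^sup>+x. F (Complex x ((s / c) * x + (1 / c) * y)) \<partial>lborel) \<partial>lborel)"
  proof (rule nn_integral_cong)
    fix y
    have "(s / c) * s + c = 1 / c" using cs c by (simp add: field_simps)
    then have "s * (s / c * y) + c * y = (1 / c) * y" 
      by (metis (no_types, lifting) distrib_right mult.assoc mult.commute)
    then have "c * (s / c * y + 1 / c * x) - s * y = x" "s * (s / c * y + 1 / c * x) + c * y = (s / c) * x + (1 / c) * y" for x
      using c by (auto simp: algebra_simps)
    then show "(\<integral>\<^sup>+x. F (Complex (c * x - s * y) (s * x + c * y)) \<partial>lborel) = ennreal \<bar>1 / c\<bar> * (\<integral>\<^sup>+x. F (Complex x ((s / c) * x + (1 / c) * y)) \<partial>lborel)"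
      using c by (subst nn_integral_real_affine[where c="1/c" and t="s / c * y"]) auto
  qed
  also have "\<dots> = ennreal \<bar>1 / c\<bar> * (\<integral>\<^sup>+y. \<integral>\<^sup>+x. F (Complex x ((s / c) * x + (1 / c) * y)) \<partial>lborel \<partial>lborel)"
    by (rule nn_integral_cmult) measurable
  also have "(\<integral>\<^sup>+y. \<integral>\<^sup>+x. F (Complex x ((s / c) * x + (1 / c) * y)) \<partial>lborel \<partial>lborel) =
     (\<integral>\<^sup>+x. \<integral>\<^sup>+y. F (Complex x ((s / c) * x + (1 / c) * y)) \<partial>lborel \<partial>lborel)"
    by (rule lborel_pair.Fubini') measurable
  also have "ennreal \<bar>1 / c\<bar> * \<dots> = (\<integral>\<^sup>+x. ennreal \<bar>1 / c\<bar> * (\<integral>\<^sup>+y. F (Complex x ((s / c) * x + (1 / c) * y)) \<partial>lborel) \<partial>lborel)"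
    by (rule nn_integral_cmult[symmetric]) measurable
  also have "\<dots> = (\<integral>\<^sup>+x. \<integral>\<^sup>+y. F (Complex x y) \<partial>lborel \<partial>lborel)"
    using c by (intro nn_integral_cong) (subst nn_integral_real_affine[where c="1/c"], auto)
  finally show ?thesis
    by (simp add: nn_integral_lborel_complex)
qed

lemma nn_integral_rotate:
  fixes F :: "complex \<Rightarrow> ennreal"
  assumes [measurable]: "F \<in> borel_measurable borel" and u: "norm u = 1"
  shows "(\<integral>\<^sup>+w. F (u * w) \<partial>lborel) = (\<integral>\<^sup>+w. F w \<partial>lborel)"
proof (cases "Re u = 0")
  case True
  \<comment> \<open>The shears degenerate here, but a square root of \<open>u\<close> has nonzero
    real part, and rotating by it twice is rotating by \<open>u\<close>.\<close>
  define v where "v = csqrt u"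
  have v: "v * v = u" by (metis power2_csqrt power2_eq_square v_def)
  then have nv: "norm v = 1"
    by (metis norm_ge_zero norm_mult u abs_of_nonneg abs_square_eq_1 power2_eq_square)
  have "Re v \<noteq> 0"
    using True u v by (auto simp: complex_eq_iff cmod_def)
  then have "(\<integral>\<^sup>+w. F (v * (v * w)) \<partial>lborel) = (\<integral>\<^sup>+w. F w \<partial>lborel)"
    using nn_integral_rotate_aux[of "\<lambda>w. F (v * w)" v] nn_integral_rotate_aux[of F v] nv by simp
  then show ?thesis by (simp flip: v mult.assoc)
qed (simp add: nn_integral_rotate_aux u)

lemma lborel_rotate:
  assumes "norm u = 1"
  shows "distr lborel borel (\<lambda>w. u * w) = (lborel :: complex measure)"
proof (rule measure_eqI)
  fix A assume "A \<in> sets (distr lborel borel (\<lambda>w. u * w))"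
  then have [measurable]: "A \<in> sets borel" by simp
  show "emeasure (distr lborel borel (\<lambda>w. u * w)) A = emeasure lborel A"
    using nn_integral_rotate[of "indicator A" u] assms
    by (simp add: nn_integral_distr flip: nn_integral_indicator)
qed simp

section \<open>Circle means as averages over rotations\<close>

abbreviation unif_angle :: "real measure" where
  "unif_angle \<equiv> uniform_measure lborel {0..<2 * pi}"

text \<open>The shifted window is cut at \<open>2*pi\<close>, and periodicity moves the overhang
  back to \<open>{0..<\<theta>}\<close>.\<close>

lemma nn_integral_unif_angle_shift:
  fixes h :: "real \<Rightarrow> ennreal"
  assumes [measurable]: "h \<in> borel_measurable borel" and per: "\<And>t. h (t + 2 * pi) = h t"
    and \<theta>: "0 \<le> \<theta>" "\<theta> < 2 * pi"
  shows "(\<integral>\<^sup>+t. h (t + \<theta>) \<partial>unif_angle) = (\<integral>\<^sup>+t. h t \<partial>unif_angle)"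
proof -
  have "(\<integral>\<^sup>+t. h (t + \<theta>) * indicator {0..<2*pi} t \<partial>lborel) = (\<integral>\<^sup>+t. h t * indicator {\<theta>..<\<theta>+2*pi} t \<partial>lborel)"
    by (subst (2) nn_integral_real_affine[where c=1 and t=\<theta>])
       (auto simp: add.commute intro!: nn_integral_cong split: split_indicator)
  also have "\<dots> = (\<integral>\<^sup>+t. h t * indicator {\<theta>..<2*pi} t + h t * indicator {2*pi..<\<theta>+2*pi} t \<partial>lborel)"
    using \<theta> by (auto intro!: nn_integral_cong split: split_indicator)
  also have "\<dots> = (\<integral>\<^sup>+t. h t * indicator {\<theta>..<2*pi} t \<partial>lborel) + (\<integral>\<^sup>+t. h t * indicator {2*pi..<\<theta>+2*pi} t \<partial>lborel)"
    by (rule nn_integral_add) auto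
  also have "(\<integral>\<^sup>+t. h t * indicator {2*pi..<\<theta>+2*pi} t \<partial>lborel) = (\<integral>\<^sup>+t. h t * indicator {0..<\<theta>} t \<partial>lborel)"
    by (subst nn_integral_real_affine[where c=1 and t="2*pi"])
       (auto simp: add.commute per intro!: nn_integral_cong split: split_indicator)
  also have "(\<integral>\<^sup>+t. h t * indicator {\<theta>..<2*pi} t \<partial>lborel) + (\<integral>\<^sup>+t. h t * indicator {0..<\<theta>} t \<partial>lborel) =
     (\<integral>\<^sup>+t. h t * indicator {\<theta>..<2*pi} t + h t * indicator {0..<\<theta>} t \<partial>lborel)"
    by (rule nn_integral_add[symmetric]) auto
  also have "\<dots> = (\<integral>\<^sup>+t. h t * indicator {0..<2*pi} t \<partial>lborel)"
    using \<theta> by (auto intro!: nn_integral_cong split: split_indicator)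
  finally show ?thesis
    by (simp add: nn_integral_uniform_measure nn_integral_divide)
qed

text \<open>\<open>circle_measure\<close> before completion; as a Borel push-forward it is open to
  change of variables and Fubini.\<close>

definition circle_distr :: "real \<Rightarrow> complex measure" where
  "circle_distr r = distr unif_angle borel (\<lambda>t. of_real r * cis t)"

lemma measurable_cis [measurable]: "cis \<in> borel_measurable borel"
  by (intro borel_measurable_continuous_onI continuous_intros)

text \<open>The argument of \<open>w\<close> merely shifts a uniformly distributed angle. The circle
  through \<open>w\<close> is thus swept out by rotating \<open>w\<close> itself.\<close>

lemma circle_distr_rotate: "distr unif_angle borel (\<lambda>t. w * cis t) = circle_distr (norm w)"
proof (cases "w = 0")
  case False
  define \<theta> where "\<theta> = Arg2pi w"
  have w: "w = of_real (norm w) * cis \<theta>" and \<theta>: "0 \<le> \<theta>" "\<theta> < 2 * pi"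
    using Arg2pi[of w] by (auto simp: \<theta>_def cis_conv_exp is_Arg_def)
  show ?thesis
  proof (rule measure_eqI)
    fix A assume "A \<in> sets (distr unif_angle borel (\<lambda>t. w * cis t))"
    then have [measurable]: "A \<in> sets borel" by simp
    have "emeasure (distr unif_angle borel (\<lambda>t. w * cis t)) A = (\<integral>\<^sup>+t. indicator A (w * cis t) \<partial>unif_angle)"
      by (simp add: nn_integral_distr flip: nn_integral_indicator)
    also have "\<dots> = (\<integral>\<^sup>+t. indicator A (of_real (norm w) * cis (t + \<theta>)) \<partial>unif_angle)"
      by (subst w) (simp add: cis_mult mult.assoc add.commute)
    also have "\<dots> = (\<integral>\<^sup>+t. indicator A (of_real (norm w) * cis t) \<partial>unif_angle)"
      using \<theta> by (intro nn_integral_unif_angle_shift) (auto simp flip: cis_mult)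
    also have "\<dots> = emeasure (circle_distr (norm w)) A"
      by (simp add: circle_distr_def nn_integral_distr flip: nn_integral_indicator)
    finally show "emeasure (distr unif_angle borel (\<lambda>t. w * cis t)) A = emeasure (circle_distr (norm w)) A" .
  qed (simp add: circle_distr_def)
qed (simp add: circle_distr_def)

lemma prob_space_unif_angle: "prob_space unif_angle"
  by (rule prob_space_uniform_measure) auto

text \<open>Fubini for null sets: every rotation preserves planar null sets, so for each angle
  almost every rotated point is good; exchanging the quantifiers gives almost every circle.\<close>

lemma AE_circle_distr:
  assumes "AE w in lborel. P w"
  shows "AE w::complex in lborel. AE v in circle_distr (norm w). P v"
proof -
  interpret prob_space unif_angle by (rule prob_space_unif_angle)
  interpret pair_sigma_finite unif_angle "lborel :: complex measure" ..
  \<comment> \<open>\<open>P\<close> need not be measurable; a Borel null set containing its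
    exceptions makes the exchange of quantifiers legitimate.\<close>
  obtain N where N: "N \<in> null_sets lborel" "{w. \<not> P w} \<subseteq> N"
    using assms by (auto simp: eventually_ae_filter)
  then have [measurable]: "N \<in> sets borel" by auto
  have "AE w in lborel. cis t * w \<notin> N" for t
  proof -
    have "AE w in distr lborel borel (\<lambda>w. cis t * w). w \<notin> N"
      using N by (subst lborel_rotate) (auto intro: AE_not_in)
    then show ?thesis by (subst (asm) AE_distr_iff) auto
  qed
  then have "AE t in unif_angle. AE w in lborel. cis t * w \<notin> N" by simp
  moreover have "{x \<in> space (unif_angle \<Otimes>\<^sub>M lborel). cis (fst x) * snd x \<notin> N} \<in> sets (unif_angle \<Otimes>\<^sub>M lborel)"
    by measurable
  ultimately have "AE w in lborel. AE t in unif_angle. cis t * w \<notin> N"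
    by (subst (asm) AE_commute)
  then show ?thesis
  proof eventually_elim
    case (elim w)
    then have "AE v in distr unif_angle borel (\<lambda>t. w * cis t). v \<notin> N"
      by (subst AE_distr_iff) (auto simp: mult.commute)
    then show ?case
      unfolding circle_distr_rotate by eventually_elim (use N in auto)
  qed
qed

text \<open>Rotating the argument leaves the integral unchanged, hence so does averaging over all
  angles; Fubini turns this average into an integral of circle means.\<close>

lemma integral_zero_of_circle_means:
  fixes F :: "complex \<Rightarrow> complex"
  assumes F: "integrable lborel F"
    and z: "AE w::complex in lborel. (LINT v|circle_distr (norm w). F v) = 0"
  shows "(LINT w|lborel. F w) = 0"
proof -
  interpret prob_space unif_angle by (rule prob_space_unif_angle)
  interpret pair_sigma_finite unif_angle "lborel :: complex measure" ..
  have [measurable]: "F \<in> borel_measurable borel" using F by auto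
  have rot: "(LINT w|lborel. F (cis t * w)) = (LINT w|lborel. F w)" for t
    by (subst (2) lborel_rotate[of "cis t", symmetric]) (auto simp: integral_distr)
  have int: "integrable (unif_angle \<Otimes>\<^sub>M lborel) (\<lambda>(t, w). F (cis t * w))"
  proof (rule integrableI_bounded)
    show "(\<lambda>(t, w). F (cis t * w)) \<in> borel_measurable (unif_angle \<Otimes>\<^sub>M lborel)"
      by (simp add: measurable_split_conv)
    have "(\<integral>\<^sup>+p. ennreal (norm (case p of (t, w) \<Rightarrow> F (cis t * w))) \<partial>(unif_angle \<Otimes>\<^sub>M lborel)) =
        (\<integral>\<^sup>+t. \<integral>\<^sup>+w. ennreal (norm (F (cis t * w))) \<partial>lborel \<partial>unif_angle)"
      by (subst lborel.nn_integral_fst[symmetric]) (auto simp: measurable_split_conv)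
    also have "\<dots> = (\<integral>\<^sup>+t. \<integral>\<^sup>+w. ennreal (norm (F w)) \<partial>lborel \<partial>unif_angle)"
      by (intro nn_integral_cong nn_integral_rotate) auto
    also have "\<dots> < \<infinity>"
      using F by (simp add: integrable_iff_bounded emeasure_space_1)
    finally show "(\<integral>\<^sup>+p. ennreal (norm (case p of (t, w) \<Rightarrow> F (cis t * w))) \<partial>(unif_angle \<Otimes>\<^sub>M lborel)) < \<infinity>" .
  qed
  have "(LINT w|lborel. F w) = (LINT t|unif_angle. LINT w|lborel. F (cis t * w))"
    by (simp add: rot prob_space)
  also have "\<dots> = (LINT w|lborel. LINT t|unif_angle. F (cis t * w))"
    by (rule Fubini_integral[symmetric, OF int])
  also have "\<dots> = (LINT w::complex|lborel. LINT v|circle_distr (norm w). F v)"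
    unfolding circle_distr_rotate[symmetric] by (subst integral_distr) (auto simp: mult.commute)
  also have "\<dots> = 0" by (rule integral_eq_zero_AE) fact
  finally show ?thesis .
qed

section \<open>From a Lebesgue measurable function to a Borel representative\<close>

text \<open>Serves for \<open>f\<close> on a single circle, where its regularity comes only from
  agreeing almost everywhere with a Borel function; the completion absorbs the set of
  disagreement.\<close>

lemma measurable_completion_AE_eq:
  fixes f g :: "'a \<Rightarrow> 'b::topological_space"
  assumes g: "g \<in> borel_measurable M" and eq: "AE x in M. f x = g x"
  shows "f \<in> borel_measurable (completion M)"
proof (rule borel_measurableI)
  fix S :: "'b set" assume S: "open S"
  obtain N where N: "N \<in> null_sets M" "{x \<in> space M. f x \<noteq> g x} \<subseteq> N"
    using eq by (auto simp: eventually_ae_filter)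
  have g': "g -` S \<inter> space M \<in> sets (completion M)"
    using S g by (auto intro!: sets_completionI_sets measurable_sets)
  have "(f -` S \<inter> space M) \<inter> N \<in> sets (completion M)"
    using N by (intro sets_completionI_sub[of N]) auto
  moreover have "f -` S \<inter> space (completion M) = ((g -` S \<inter> space M) - N) \<union> ((f -` S \<inter> space M) \<inter> N)"
    using N by auto
  moreover have "N \<in> sets (completion M)" using N by (auto intro: sets_completionI_sets)
  ultimately show "f -` S \<inter> space (completion M) \<in> sets (completion M)"
    using g' by (metis sets.Diff sets.Un)
qed

lemma lebesgue_ex_borel_complex:
  fixes f :: "'a::euclidean_space \<Rightarrow> complex"
  assumes "f \<in> borel_measurable lebesgue"
  obtains g where "g \<in> borel_measurable borel" "AE x in lborel. f x = g x"
proof -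
  have "(\<lambda>x. Re (f x)) \<in> borel_measurable lebesgue" "(\<lambda>x. Im (f x)) \<in> borel_measurable lebesgue"
    using assms by measurable
  then obtain u v where uv: "u \<in> borel_measurable lborel" "v \<in> borel_measurable lborel"
      and eq: "AE x in lborel. Re (f x) = u x" "AE x in lborel. Im (f x) = v x"
    by (metis completion_ex_borel_measurable_real)
  show thesis
  proof
    show "(\<lambda>x. Complex (u x) (v x)) \<in> borel_measurable borel"
      unfolding Complex_eq using uv by simp
    show "AE x in lborel. f x = Complex (u x) (v x)"
      using eq by eventually_elim (simp add: complex_eq_iff)
  qed
qed

lemma circle_measure_eq: "circle_measure r = completion (circle_distr r)"
  by (simp add: circle_measure_def circle_distr_def)

lemma AE_circle_distr_norm: "AE v in circle_distr r. norm v = \<bar>r\<bar>"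
  unfolding circle_distr_def by (subst AE_distr_iff) (auto simp: norm_mult)

lemma lborel_reflect: "distr lborel borel (\<lambda>w. z - w) = (lborel :: complex measure)"
  using lborel_affine[of "-1" z] by (simp add: density_1)

lemma AE_lborel_reflect:
  fixes z :: complex
  assumes "AE w in lborel. P w"
  shows "AE w in lborel. P (z - w)"
proof -
  have "(\<lambda>w. z - w) \<in> lborel \<rightarrow>\<^sub>M borel" by measurable
  moreover have "AE w in distr lborel borel (\<lambda>w. z - w). P w" by (subst lborel_reflect) (rule assms)
  ultimately show ?thesis by (rule AE_distrD)
qed

text \<open>The Gaussian is constant on circles about 0, so it factors out of each circle mean and
  leaves a twisted mean. Fubini is applied to the Borel function \<open>g\<close>, while the
  hypothesis on the means concerns \<open>f\<close>.\<close>

lemma gaussian_integral_zero_of_twisted_means: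
  fixes f g :: "complex \<Rightarrow> complex"
  assumes [measurable]: "g \<in> borel_measurable borel" and fg: "AE w in lborel. f w = g w"
    and tm: "\<And>r. r > 0 \<Longrightarrow> twisted_mean f r z = 0"
    and int: "integrable lborel (\<lambda>w. g (z - w) * exp (\<i> / 2 * of_real (Im (z * cnj w))) * exp (- of_real (a * (norm w)\<^sup>2)))"
  shows "(LINT w|lborel. g (z - w) * exp (\<i> / 2 * of_real (Im (z * cnj w))) * exp (- of_real (a * (norm w)\<^sup>2))) = 0"
proof (rule integral_zero_of_circle_means[OF int])
  have "AE w::complex in lborel. AE v in circle_distr (norm w). f (z - v) = g (z - v)"
    by (intro AE_circle_distr AE_lborel_reflect fg)
  \<comment> \<open>The vanishing of the means is assumed only for positive radii.\<close>
  moreover have "AE w::complex in lborel. w \<noteq> 0"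
    by (rule AE_lborel_singleton)
  ultimately show "AE w::complex in lborel. (LINT v|circle_distr (norm w).
      g (z - v) * exp (\<i> / 2 * of_real (Im (z * cnj v))) * exp (- of_real (a * (norm v)\<^sup>2))) = 0"
  proof eventually_elim
    case (elim w)
    define E where "E v = exp (\<i> / 2 * complex_of_real (Im (z * cnj v)))" for v
    have [measurable]: "E \<in> borel_measurable borel"
      unfolding E_def by (intro borel_measurable_continuous_onI continuous_intros)
    have sets[measurable_cong, simp]: "sets (circle_distr (norm w)) = sets borel" by (simp add: circle_distr_def)
    \<comment> \<open>Almost everywhere on the circle \<open>norm v = norm w\<close>, which freezes
      the Gaussian factor.\<close>
    have "(LINT v|circle_distr (norm w). g (z - v) * E v * exp (- of_real (a * (norm v)\<^sup>2))) =
        (LINT v|circle_distr (norm w). (g (z - v) * E v) * exp (- of_real (a * (norm w)\<^sup>2)))"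
      using AE_circle_distr_norm[of "norm w"] by (intro integral_cong_AE) (auto elim: eventually_mono)
    also have "\<dots> = (LINT v|circle_distr (norm w). g (z - v) * E v) * exp (- of_real (a * (norm w)\<^sup>2))"
      by simp
    also have "(LINT v|circle_distr (norm w). g (z - v) * E v) = (LINT v|circle_measure (norm w). g (z - v) * E v)"
      unfolding circle_measure_eq by (rule integral_completion[symmetric]) simp
    \<comment> \<open>Equality almost everywhere does not suffice for equal Bochner integrals;
      \<open>f\<close> must also be measurable on the completed circle.\<close>
    also have "\<dots> = (LINT v|circle_measure (norm w). f (z - v) * E v)"
    proof (rule integral_cong_AE)
      have ae: "AE v in circle_distr (norm w). f (z - v) * E v = g (z - v) * E v"
        using elim(1) by eventually_elim simp
      then show "(\<lambda>v. f (z - v) * E v) \<in> borel_measurable (circle_measure (norm w))"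
        unfolding circle_measure_eq by (rule measurable_completion_AE_eq[rotated]) simp
      show "(\<lambda>v. g (z - v) * E v) \<in> borel_measurable (circle_measure (norm w))"
        unfolding circle_measure_eq by (rule measurable_completion) simp
      show "AE v in circle_measure (norm w). g (z - v) * E v = f (z - v) * E v"
        unfolding circle_measure_eq using ae by (intro AE_completion) (auto elim: eventually_mono)
    qed
    also have "\<dots> = 0" using tm[of "norm w"] elim(2) by (simp add: twisted_mean_def E_def)
    finally show ?case by (simp add: E_def)
  qed
qed

subsection \<open>Gaussian moments\<close>

lemma integrable_gaussian_complex:
  assumes "a > 0"
  shows "integrable lborel (\<lambda>w::complex. exp (- (a * (norm w)\<^sup>2)))"
proof (rule integrableI_bounded)
  have sq: "integrable lborel (\<lambda>x::real. exp (- (a * x\<^sup>2)))"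
  proof -
    \<comment> \<open>The centred normal density of variance \<open>1 / (2 * a)\<close> with its
      normalization undone.\<close>
    have "integrable lborel (\<lambda>x. sqrt (2 * pi * (1 / (2 * a))) * normal_density 0 (sqrt (1 / (2 * a))) x)"
      using assms by (intro integrable_mult_right integrable_normal_density) auto
    also have "(\<lambda>x. sqrt (2 * pi * (1 / (2 * a))) * normal_density 0 (sqrt (1 / (2 * a))) x) = (\<lambda>x. exp (- (a * x\<^sup>2)))"
    proof
      fix x
      have "sqrt (2 * pi * (1 / (2 * a))) > 0" using assms by simp
      moreover have sq2: "(sqrt (1 / (2 * a)))\<^sup>2 = 1 / (2 * a)" using assms by simp
      moreover have "- x\<^sup>2 / (2 * (1 / (2 * a))) = - (a * x\<^sup>2)" using assms by simp
      ultimately show "sqrt (2 * pi * (1 / (2 * a))) * normal_density 0 (sqrt (1 / (2 * a))) x = exp (- (a * x\<^sup>2))"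
        unfolding normal_density_def sq2 diff_zero using assms by simp
    qed
    finally show ?thesis .
  qed
  define I where "I = (\<integral>\<^sup>+x. ennreal (exp (- (a * x\<^sup>2))) \<partial>lborel)"
  have I: "I < \<infinity>" using sq by (simp add: integrable_iff_bounded I_def)
  have "(\<integral>\<^sup>+w. ennreal (norm (exp (- (a * (norm (w::complex))\<^sup>2)))) \<partial>lborel) =
      (\<integral>\<^sup>+x. \<integral>\<^sup>+y. ennreal (exp (- (a * x\<^sup>2))) * ennreal (exp (- (a * y\<^sup>2))) \<partial>lborel \<partial>lborel)"
    by (subst nn_integral_lborel_complex)
       (auto simp: cmod_def distrib_left simp flip: ennreal_mult exp_add intro!: nn_integral_cong)
  also have "\<dots> = I * I" by (simp add: nn_integral_cmult nn_integral_multc I_def)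
  also have "\<dots> < \<infinity>" using I by (simp add: ennreal_mult_less_top)
  finally show "(\<integral>\<^sup>+w. ennreal (norm (exp (- (a * (norm (w::complex))\<^sup>2)))) \<partial>lborel) < \<infinity>" .
qed measurable

text \<open>Pointwise domination: the Gaussian alone dominates where
  \<open>norm (g w) \<le> 1\<close>; elsewhere \<open>q \<ge> 1\<close> gives
  \<open>norm (g w) \<le> norm (g w) powr q\<close>.\<close>

lemma Lq_gaussian_integrable:
  fixes g :: "complex \<Rightarrow> complex"
  assumes [measurable]: "g \<in> borel_measurable borel" and int: "integrable lborel (\<lambda>w. norm (g w) powr q)" and "1 \<le> q" "a > 0"
  shows "integrable lborel (\<lambda>w::complex. norm (g w) * exp (- (a * (norm w)\<^sup>2)))"
proof (rule Bochner_Integration.integrable_bound)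
  show "integrable lborel (\<lambda>w. exp (- (a * (norm w)\<^sup>2)) + norm (g w) powr q)"
    by (intro Bochner_Integration.integrable_add integrable_gaussian_complex int assms)
  show "AE w in lborel. norm (norm (g w) * exp (- (a * (norm w)\<^sup>2))) \<le> norm (exp (- (a * (norm w)\<^sup>2)) + norm (g w) powr q)"
  proof (rule AE_I2)
    fix w :: complex
    let ?e = "exp (- (a * (norm w)\<^sup>2))"
    have e: "0 \<le> ?e" "?e \<le> 1" using assms by auto
    have "norm (g w) * ?e \<le> ?e + norm (g w) powr q"
    proof (cases "norm (g w) \<le> 1")
      case True
      then have "norm (g w) * ?e \<le> 1 * ?e" by (intro mult_right_mono) auto
      then show ?thesis by (simp add: add_increasing2)
    next
      case False
      then have "norm (g w) powr 1 \<le> norm (g w) powr q" using assms by (intro powr_mono) auto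
      moreover have "norm (g w) * ?e \<le> norm (g w) * 1" using e by (intro mult_left_mono) auto
      ultimately have "norm (g w) * ?e \<le> norm (g w) powr q" using False by simp
      then show ?thesis using e(1) by linarith
    qed
    then show "norm (norm (g w) * ?e) \<le> norm (?e + norm (g w) powr q)" by simp
  qed
qed measurable

text \<open>One term of the exponential series is at most the whole sum. Powers are thereby
  dominated by functions of exponential type.\<close>

lemma power_le_fact_mult_exp:
  fixes x :: real
  assumes "x \<ge> 0"
  shows "x ^ n \<le> fact n * exp x"
proof -
  have "(\<lambda>n. x ^ n / fact n) sums exp x"
    using exp_converges[of x] by (simp add: divide_inverse mult.commute)
  then have "(\<Sum>k\<in>{n}. x ^ k / fact k) \<le> exp x"
    using assms by (intro sum_le_suminf[of "\<lambda>n. x ^ n / fact n", THEN order_trans]) (auto simp: sums_iff)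
  then show ?thesis by (simp add: field_simps)
qed

lemma measurable_cnj [measurable]: "cnj \<in> borel_measurable borel"
  by (intro borel_measurable_continuous_onI continuous_intros)

abbreviation gauss :: "real \<Rightarrow> complex \<Rightarrow> complex" where
  "gauss a w \<equiv> of_real (exp (- (a * (norm w)\<^sup>2)))"

text \<open>All that is retained of membership in \<open>Lq\<close>. Allowing every width leaves
  room to absorb exponential factors.\<close>

locale gauss_tempered =
  fixes g :: "complex \<Rightarrow> complex"
  assumes meas [measurable]: "g \<in> borel_measurable borel"
    and gauss_integrable: "a > 0 \<Longrightarrow> integrable lborel (\<lambda>w. norm (g w) * exp (- (a * (norm w)\<^sup>2)))"
begin

text \<open>By completing the square, half of the Gaussian absorbs the exponential factor and the
  other half keeps the product integrable.\<close>

lemma dominating_integrable: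
  assumes "a > 0"
  shows "integrable lborel (\<lambda>w. norm (g w) * exp (k * norm w) * exp (- (a * (norm w)\<^sup>2)))"
proof (rule Bochner_Integration.integrable_bound)
  show "integrable lborel (\<lambda>w. exp (k\<^sup>2 / (2 * a)) * (norm (g w) * exp (- (a / 2 * (norm w)\<^sup>2))))"
    using assms by (intro integrable_mult_right gauss_integrable) auto
  show "AE w in lborel. norm (norm (g w) * exp (k * norm w) * exp (- (a * (norm w)\<^sup>2)))
      \<le> norm (exp (k\<^sup>2 / (2 * a)) * (norm (g w) * exp (- (a / 2 * (norm w)\<^sup>2))))"
  proof (rule AE_I2)
    fix w :: complex
    have "0 \<le> a / 2 * (norm w - k / a)\<^sup>2" using assms by simp
    also have "\<dots> = k\<^sup>2 / (2 * a) + a / 2 * (norm w)\<^sup>2 - k * norm w"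
      using assms by (simp add: power2_eq_square field_simps)
    finally have "k * norm w + - (a * (norm w)\<^sup>2) \<le> k\<^sup>2 / (2 * a) + - (a / 2 * (norm w)\<^sup>2)" by simp
    then have "exp (k * norm w) * exp (- (a * (norm w)\<^sup>2)) \<le> exp (k\<^sup>2 / (2 * a)) * exp (- (a / 2 * (norm w)\<^sup>2))"
      unfolding exp_add[symmetric] by simp
    then have "norm (g w) * (exp (k * norm w) * exp (- (a * (norm w)\<^sup>2))) \<le>
      norm (g w) * (exp (k\<^sup>2 / (2 * a)) * exp (- (a / 2 * (norm w)\<^sup>2)))"
      by (intro mult_left_mono) auto
    then show "norm (norm (g w) * exp (k * norm w) * exp (- (a * (norm w)\<^sup>2)))
      \<le> norm (exp (k\<^sup>2 / (2 * a)) * (norm (g w) * exp (- (a / 2 * (norm w)\<^sup>2))))"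
      by (simp add: mult_ac)
  qed
qed measurable

lemma exp_type_integrable:
  assumes [measurable]: "h \<in> borel_measurable borel" and h: "\<And>w. norm (h w) \<le> C * exp (k * norm w)" and "a > 0"
  shows "integrable lborel (\<lambda>w. g w * h w * gauss a w)"
proof (rule Bochner_Integration.integrable_bound)
  show "integrable lborel (\<lambda>w. C * (norm (g w) * exp (k * norm w) * exp (- (a * (norm w)\<^sup>2))))"
    by (intro integrable_mult_right dominating_integrable assms)
  show "AE w in lborel. norm (g w * h w * gauss a w) \<le> norm (C * (norm (g w) * exp (k * norm w) * exp (- (a * (norm w)\<^sup>2))))"
  proof (rule AE_I2)
    fix w
    have "norm (h w) * (norm (g w) * exp (- (a * (norm w)\<^sup>2))) \<le> C * exp (k * norm w) * (norm (g w) * exp (- (a * (norm w)\<^sup>2)))"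
      by (intro mult_right_mono h) auto
    then show "norm (g w * h w * gauss a w) \<le> norm (C * (norm (g w) * exp (k * norm w) * exp (- (a * (norm w)\<^sup>2))))"
      unfolding real_norm_def by (intro order_trans[OF _ abs_ge_self]) (simp add: norm_mult mult_ac)
  qed
qed measurable

text \<open>Termwise integration by dominated convergence: all partial sums of the exponential
  series share the bound \<open>exp (norm x * C * norm w)\<close>. With \<open>x\<close> complex,
  the integral becomes an entire function of \<open>x\<close>.\<close>

lemma exp_integral_sums:
  fixes P :: "complex \<Rightarrow> complex"
  assumes [measurable]: "P \<in> borel_measurable borel" and P: "\<And>w. norm (P w) \<le> C * norm w" and a: "a > 0"
  shows "(\<lambda>n. (LINT w|lborel. g w * P w ^ n * gauss a w) / fact n * x ^ n) sums (LINT w|lborel. g w * exp (x * P w) * gauss a w)"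
proof -
  have C: "C \<ge> 0" using P[of 1] order_trans[OF norm_ge_zero P[of 1]] by simp
  have int: "integrable lborel (\<lambda>w. g w * P w ^ n * gauss a w)" for n
  proof (rule exp_type_integrable[OF _ _ a])
    show "norm (P w ^ n) \<le> fact n * exp (C * norm w)" for w
    proof -
      have "norm (P w ^ n) \<le> (C * norm w) ^ n" unfolding norm_power by (intro power_mono P) auto
      also have "\<dots> \<le> fact n * exp (C * norm w)" using C by (intro power_le_fact_mult_exp) auto
      finally show ?thesis .
    qed
  qed measurable
  define S where "S n w = (\<Sum>i<n. (x * P w) ^ i /\<^sub>R fact i)" for n w
  have [measurable]: "S n \<in> borel_measurable borel" for n unfolding S_def by measurable
  have S_bound: "norm (S n w) \<le> exp (norm x * C * norm w)" for n w
  proof -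
    have "norm (S n w) \<le> (\<Sum>i<n. norm (x * P w) ^ i /\<^sub>R fact i)"
      unfolding S_def by (intro sum_norm_le) (simp add: norm_power)
    also have "\<dots> \<le> exp (norm (x * P w))"
      using exp_converges[of "norm (x * P w)"]
        sum_le_suminf[of "\<lambda>i. norm (x * P w) ^ i /\<^sub>R fact i" "{..<n}"] by (simp add: sums_iff)
    also have "\<dots> \<le> exp (norm x * C * norm w)"
      using P[of w] by (simp add: norm_mult mult.assoc mult_left_mono)
    finally show ?thesis .
  qed
  have "(\<lambda>n. LINT w|lborel. g w * S n w * gauss a w) \<longlonglongrightarrow> (LINT w|lborel. g w * exp (x * P w) * gauss a w)"
  proof (rule integral_dominated_convergence[where w="\<lambda>w. norm (g w) * exp (norm x * C * norm w) * exp (- (a * (norm w)\<^sup>2))"])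
    show "AE w in lborel. (\<lambda>n. g w * S n w * gauss a w) \<longlonglongrightarrow> g w * exp (x * P w) * gauss a w"
      unfolding S_def by (intro AE_I2 tendsto_intros exp_converges[unfolded sums_def])
    show "AE w in lborel. norm (g w * S n w * gauss a w) \<le> norm (g w) * exp (norm x * C * norm w) * exp (- (a * (norm w)\<^sup>2))" for n
      by (intro AE_I2) (auto simp: norm_mult intro!: mult_right_mono mult_left_mono S_bound)
  qed (use dominating_integrable a in auto)
  moreover have "(LINT w|lborel. g w * S n w * gauss a w) = (\<Sum>i<n. (LINT w|lborel. g w * P w ^ i * gauss a w) / fact i * x ^ i)" for n
  proof -
    have "(LINT w|lborel. g w * S n w * gauss a w) = (LINT w|lborel. (\<Sum>i<n. (x ^ i / fact i) * (g w * P w ^ i * gauss a w)))"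
      unfolding S_def by (intro Bochner_Integration.integral_cong)
        (simp_all add: sum_distrib_left sum_distrib_right power_mult_distrib scaleR_conv_of_real divide_inverse mult_ac)
    also have "\<dots> = (\<Sum>i<n. (LINT w|lborel. (x ^ i / fact i) * (g w * P w ^ i * gauss a w)))"
      by (intro Bochner_Integration.integral_sum integrable_mult_right int)
    finally show ?thesis unfolding integral_mult_right_zero by (simp add: mult.commute[of "x ^ _"])
  qed
  ultimately show ?thesis by (simp add: sums_def)
qed

text \<open>The integral is an entire function of \<open>x\<close> that vanishes on the real line;
  since zeros of a nonzero power series are isolated, every coefficient vanishes.\<close>

lemma power_integral_eq_0:
  fixes P :: "complex \<Rightarrow> complex"
  assumes P: "P \<in> borel_measurable borel" "\<And>w. norm (P w) \<le> C * norm w" and a: "a > 0"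
    and 0: "\<And>x::real. (LINT w|lborel. g w * exp (of_real x * P w) * gauss a w) = 0"
  shows "(LINT w|lborel. g w * P w ^ n * gauss a w) = 0"
proof (rule ccontr)
  assume nz: "(LINT w|lborel. g w * P w ^ n * gauss a w) \<noteq> 0"
  define I where "I x = (LINT w|lborel. g w * exp (x * P w) * gauss a w)" for x
  \<comment> \<open>\<open>powser_0_nonzero\<close> asks for a nonzero coefficient of positive
    index; index 0 is settled by \<open>x = 0\<close>.\<close>
  have "n \<noteq> 0"
  proof
    assume "n = 0"
    with nz 0[of 0] show False by simp
  qed
  obtain s where "s > 0" "\<And>z. z \<in> cball 0 s - {0} \<Longrightarrow> I z \<noteq> 0"
  proof (rule powser_0_nonzero[of 1 0 "\<lambda>n. (LINT w|lborel. g w * P w ^ n * gauss a w) / fact n" I n])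
    show "(\<lambda>n. (LINT w|lborel. g w * P w ^ n * gauss a w) / fact n * (x - 0) ^ n) sums I x" for x
      unfolding I_def using exp_integral_sums[OF P a] by simp
    show "I 0 = 0" using 0[of 0] by (simp add: I_def)
  qed (use nz \<open>n \<noteq> 0\<close> in auto)
  \<comment> \<open>The zero-free punctured disc contains the real point \<open>s\<close>.\<close>
  from this(2)[of "of_real s"] \<open>s > 0\<close> show False using 0[of s] by (simp add: I_def)
qed

definition moment :: "nat \<Rightarrow> nat \<Rightarrow> real \<Rightarrow> complex" where
  "moment j l a = (LINT w|lborel. g w * (w ^ j * cnj w ^ l) * gauss a w)"

lemma moment_integrable:
  assumes "a > 0"
  shows "integrable lborel (\<lambda>w. g w * (w ^ j * cnj w ^ l) * gauss a w)"
proof (rule exp_type_integrable[OF _ _ assms])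
  show "norm (w ^ j * cnj w ^ l) \<le> fact (j + l) * exp (1 * norm w)" for w
    using power_le_fact_mult_exp[of "norm w" "j + l"] by (simp add: norm_mult norm_power power_add)
qed measurable

lemma linear_power_integral:
  assumes "a > 0"
  shows "(LINT w|lborel. g w * (\<alpha> * w + \<beta> * cnj w) ^ n * gauss a w) =
    (\<Sum>l\<le>n. of_nat (n choose l) * \<alpha> ^ (n - l) * \<beta> ^ l * moment (n - l) l a)"
proof -
  have "(\<alpha> * w + \<beta> * cnj w) ^ n = (\<Sum>l\<le>n. of_nat (n choose l) * (\<beta> * cnj w) ^ l * (\<alpha> * w) ^ (n - l))" for w
    by (subst add.commute) (rule binomial_ring)
  then have "(LINT w|lborel. g w * (\<alpha> * w + \<beta> * cnj w) ^ n * gauss a w) =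
    (LINT w|lborel. (\<Sum>l\<le>n. (of_nat (n choose l) * \<alpha> ^ (n - l) * \<beta> ^ l) * (g w * (w ^ (n - l) * cnj w ^ l) * gauss a w)))"
    by (intro Bochner_Integration.integral_cong)
       (simp_all add: sum_distrib_left sum_distrib_right power_mult_distrib mult_ac)
  also have "\<dots> = (\<Sum>l\<le>n. LINT w|lborel. (of_nat (n choose l) * \<alpha> ^ (n - l) * \<beta> ^ l) * (g w * (w ^ (n - l) * cnj w ^ l) * gauss a w))"
    by (intro Bochner_Integration.integral_sum integrable_mult_right moment_integrable assms)
  finally show ?thesis by (simp add: moment_def)
qed

text \<open>Differentiation under the integral: the derivative in \<open>a\<close> brings down
  \<open>- (norm w)^2\<close>, that is \<open>- w * cnj w\<close>, raising both exponents. The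
  discrete steps turn it into a limit of a sequence, fit for dominated convergence.\<close>

lemma moment_difference_quotient:
  assumes a: "a > 0"
  shows "(\<lambda>n. of_nat (Suc n) * (moment j l a - moment j l (a + 1 / real (Suc n)))) \<longlonglongrightarrow> moment (Suc j) (Suc l) a"
proof -
  \<comment> \<open>\<open>gauss a w * D n w\<close> is the scaled difference of the two Gaussians;
    \<open>1 - exp (- t) \<le> t\<close> bounds \<open>D n w\<close> by \<open>(norm w)^2\<close>
    for all \<open>n\<close>.\<close>
  define D where "D n w = complex_of_real (real (Suc n) * (1 - exp (- ((norm w)\<^sup>2 / real (Suc n)))))" for n and w :: complex
  have "(\<lambda>n. LINT w|lborel. g w * (w ^ j * cnj w ^ l) * gauss a w * D n w) \<longlonglongrightarrow>
     (LINT w|lborel. g w * (w ^ Suc j * cnj w ^ Suc l) * gauss a w)"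
  proof (rule integral_dominated_convergence[where w="\<lambda>w. norm (g w * (w ^ Suc j * cnj w ^ Suc l) * gauss a w)"])
    show "AE w in lborel. (\<lambda>n. g w * (w ^ j * cnj w ^ l) * gauss a w * D n w) \<longlonglongrightarrow> g w * (w ^ Suc j * cnj w ^ Suc l) * gauss a w"
    proof (rule AE_I2)
      fix w :: complex
      have "(\<lambda>n. real (Suc n) * (1 - exp (- ((norm w)\<^sup>2 / real (Suc n))))) \<longlonglongrightarrow> (norm w)\<^sup>2"
        by real_asymp
      then have "(\<lambda>n. D n w) \<longlonglongrightarrow> of_real ((norm w)\<^sup>2)" unfolding D_def by (rule tendsto_of_real)
      then have "(\<lambda>n. g w * (w ^ j * cnj w ^ l) * gauss a w * D n w) \<longlonglongrightarrow> g w * (w ^ j * cnj w ^ l) * gauss a w * of_real ((norm w)\<^sup>2)"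
        by (intro tendsto_intros)
      also have "g w * (w ^ j * cnj w ^ l) * gauss a w * of_real ((norm w)\<^sup>2) = g w * (w ^ Suc j * cnj w ^ Suc l) * gauss a w"
        by (simp add: complex_norm_square mult_ac del: of_real_power)
      finally show "(\<lambda>n. g w * (w ^ j * cnj w ^ l) * gauss a w * D n w) \<longlonglongrightarrow> g w * (w ^ Suc j * cnj w ^ Suc l) * gauss a w" .
    qed
    show "AE w in lborel. norm (g w * (w ^ j * cnj w ^ l) * gauss a w * D n w) \<le> norm (g w * (w ^ Suc j * cnj w ^ Suc l) * gauss a w)" for n
    proof (rule AE_I2)
      fix w :: complex
      define t where "t = (norm w)\<^sup>2 / real (Suc n)"
      have t: "t \<ge> 0" "1 - exp (- t) \<le> t" "exp (- t) \<le> 1" using exp_ge_add_one_self[of "- t"] by (auto simp: t_def)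
      then have "norm (D n w) \<le> real (Suc n) * t"
        unfolding D_def t_def[symmetric] norm_of_real abs_mult by (intro mult_mono) auto
      also have "\<dots> = norm w * norm w" by (simp add: t_def power2_eq_square)
      finally have D: "norm (D n w) \<le> norm w * norm w" .
      have "norm (g w * (w ^ j * cnj w ^ l) * gauss a w) * norm (D n w) \<le> norm (g w * (w ^ j * cnj w ^ l) * gauss a w) * (norm w * norm w)"
        by (intro mult_left_mono D) auto
      also have "\<dots> = norm (g w * (w ^ Suc j * cnj w ^ Suc l) * gauss a w)" by (simp add: norm_mult mult_ac)
      finally show "norm (g w * (w ^ j * cnj w ^ l) * gauss a w * D n w) \<le> norm (g w * (w ^ Suc j * cnj w ^ Suc l) * gauss a w)"
        by (simp add: norm_mult)
    qed
    show "(\<lambda>w. g w * (w ^ j * cnj w ^ l) * gauss a w * D n w) \<in> borel_measurable lborel" for n unfolding D_def by measurable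
  qed (use moment_integrable[OF a, of "Suc j" "Suc l"] in auto)
  moreover have "(LINT w|lborel. g w * (w ^ j * cnj w ^ l) * gauss a w * D n w) =
      of_nat (Suc n) * (moment j l a - moment j l (a + 1 / real (Suc n)))" for n
  proof -
    have "of_nat (Suc n) * (moment j l a - moment j l (a + 1 / real (Suc n))) =
       (LINT w|lborel. of_nat (Suc n) * (g w * (w ^ j * cnj w ^ l) * gauss a w - g w * (w ^ j * cnj w ^ l) * gauss (a + 1 / real (Suc n)) w))"
      using a by (simp add: moment_def moment_integrable add_pos_pos)
    also have "\<dots> = (LINT w|lborel. g w * (w ^ j * cnj w ^ l) * gauss a w * D n w)"
    proof (intro Bochner_Integration.integral_cong refl)
      fix w
      have "gauss (a + 1 / real (Suc n)) w = gauss a w * of_real (exp (- ((norm w)\<^sup>2 / real (Suc n))))"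
        by (simp add: distrib_right add.commute flip: exp_add of_real_mult)
      then show "of_nat (Suc n) * (g w * (w ^ j * cnj w ^ l) * gauss a w - g w * (w ^ j * cnj w ^ l) * gauss (a + 1 / real (Suc n)) w)
         = g w * (w ^ j * cnj w ^ l) * gauss a w * D n w"
        by (simp add: D_def algebra_simps del: of_nat_Suc)
    qed
    finally show ?thesis by simp
  qed
  ultimately show ?thesis by (simp add: moment_def)
qed

end

subsection \<open>Vanishing on the two axes\<close>

lemma power_difference_quotient:
  fixes c :: real
  shows "(\<lambda>n. real (Suc n) * ((c + 1 / real (Suc n)) ^ p - c ^ p)) \<longlonglongrightarrow> real p * c ^ (p - 1)"
proof -
  have "DERIV (\<lambda>x. x ^ p) c :> real p * c ^ (p - 1)" by (auto intro!: derivative_eq_intros)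
  then have "((\<lambda>h. ((c + h) ^ p - c ^ p) / h) \<longlongrightarrow> real p * c ^ (p - 1)) (at 0)" by (simp add: DERIV_def)
  moreover have "filterlim (\<lambda>n. 1 / real (Suc n)) (at 0) sequentially"
    by (rule filterlim_atI) (use LIMSEQ_inverse_real_of_nat in \<open>auto simp: divide_inverse\<close>)
  ultimately have "(\<lambda>n. ((c + 1 / real (Suc n)) ^ p - c ^ p) / (1 / real (Suc n))) \<longlonglongrightarrow> real p * c ^ (p - 1)"
    by (rule filterlim_compose)
  then show ?thesis by (simp add: mult.commute)
qed

section \<open>Vanishing of all Gaussian moments\<close>

locale cross_vanishing = gauss_tempered +
  assumes cross: "a > 1/4 \<Longrightarrow> \<zeta> = 1 \<or> \<zeta> = \<i> \<Longrightarrow>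
    (LINT w|lborel. g w * exp (of_real x * (of_real (a + 1/4) * cnj \<zeta> * w + of_real (a - 1/4) * \<zeta> * cnj w)) * gauss a w) = 0"
begin

text \<open>The binomial term for \<open>\<zeta> = 1\<close>; the one for
  \<open>\<zeta> = \<i>\<close> differs from it by the factor
  \<open>(-\<i>) ^ n * (-1) ^ l\<close>.\<close>

definition term_at :: "nat \<Rightarrow> real \<Rightarrow> nat \<Rightarrow> complex" where
  "term_at n a l = of_nat (n choose l) * of_real ((a + 1/4) ^ (n - l) * (a - 1/4) ^ l) * moment (n - l) l a"

lemma binomial_moment_sum_eq_0:
  assumes a: "a > 1/4" and \<zeta>: "\<zeta> = 1 \<or> \<zeta> = \<i>"
  shows "(\<Sum>l\<le>n. of_nat (n choose l) * (of_real (a + 1/4) * cnj \<zeta>) ^ (n - l) * (of_real (a - 1/4) * \<zeta>) ^ l * moment (n - l) l a) = 0"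
proof -
  let ?P = "\<lambda>w. of_real (a + 1/4) * cnj \<zeta> * w + of_real (a - 1/4) * \<zeta> * cnj w"
  have "(LINT w|lborel. g w * ?P w ^ n * gauss a w) = 0"
  proof (rule power_integral_eq_0)
    show "norm (?P w) \<le> (norm (of_real (a + 1/4) * cnj \<zeta>) + norm (of_real (a - 1/4) * \<zeta>)) * norm w" for w
      by (rule norm_triangle_ineq[THEN order_trans]) (simp only: norm_mult complex_mod_cnj distrib_right order_refl)
  qed (use a cross[OF a \<zeta>] in auto)
  then show ?thesis using a by (subst (asm) linear_power_integral) auto
qed

text \<open>The second axis gives the alternating version of the sum from the first; adding and
  subtracting the two separates the parities.\<close>

lemma parity_sum_eq_0:
  assumes a: "a > 1/4"
  shows "(\<Sum>l | l \<le> n \<and> even l. term_at n a l) = 0" and "(\<Sum>l | l \<le> n \<and> odd l. term_at n a l) = 0"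
proof -
  have split: "(\<Sum>l\<le>n. h l) = (\<Sum>l | l \<le> n \<and> even l. h l) + (\<Sum>l | l \<le> n \<and> odd l. h l)" for h :: "nat \<Rightarrow> complex"
    by (subst sum.union_disjoint[symmetric]) (auto intro!: sum.cong)
  have "(\<Sum>l\<le>n. term_at n a l) = 0"
    using binomial_moment_sum_eq_0[OF a, of 1 n] by (simp add: term_at_def mult.assoc)
  then have 1: "(\<Sum>l | l \<le> n \<and> even l. term_at n a l) + (\<Sum>l | l \<le> n \<and> odd l. term_at n a l) = 0"
    by (simp add: split)
  have "(\<Sum>l\<le>n. of_nat (n choose l) * (of_real (a + 1/4) * cnj \<i>) ^ (n - l) * (of_real (a - 1/4) * \<i>) ^ l * moment (n - l) l a)
      = (\<Sum>l\<le>n. (-\<i>) ^ n * ((-1) ^ l * term_at n a l))"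
  proof (rule sum.cong)
    fix l assume "l \<in> {..n}"
    then have n: "n = (n - l) + l" by simp
    have "(-\<i>) ^ n = (-\<i>) ^ (n - l) * (-\<i>) ^ l" by (subst n) (rule power_add)
    moreover have "\<i> ^ l = (-\<i>) ^ l * (-1) ^ l" by (simp flip: power_mult_distrib)
    ultimately show "of_nat (n choose l) * (of_real (a + 1/4) * cnj \<i>) ^ (n - l) * (of_real (a - 1/4) * \<i>) ^ l * moment (n - l) l a
      = (-\<i>) ^ n * ((-1) ^ l * term_at n a l)"
      by (simp only: term_at_def power_mult_distrib of_real_mult of_real_power complex_cnj_i mult_ac)
  qed simp
  then have "(-\<i>) ^ n * (\<Sum>l\<le>n. (-1) ^ l * term_at n a l) = 0"
    using binomial_moment_sum_eq_0[OF a, of \<i> n] by (simp add: sum_distrib_left)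
  then have "(\<Sum>l\<le>n. (-1) ^ l * term_at n a l) = 0" by simp
  then have 2: "(\<Sum>l | l \<le> n \<and> even l. term_at n a l) - (\<Sum>l | l \<le> n \<and> odd l. term_at n a l) = 0"
    by (simp add: split sum_negf)
  from 1 2 show "(\<Sum>l | l \<le> n \<and> even l. term_at n a l) = 0" "(\<Sum>l | l \<le> n \<and> odd l. term_at n a l) = 0"
    by (auto simp: complex_eq_iff)
qed

text \<open>Up to sign this is the derivative of a function of \<open>a\<close> that vanishes
  identically.\<close>

lemma moment_Suc_Suc_eq_0:
  assumes "\<And>a. a > 1/4 \<Longrightarrow> moment j l a = 0" and "a > 1/4"
  shows "moment (Suc j) (Suc l) a = 0"
proof -
  have "moment j l (a + 1 / real (Suc n)) = 0" for n
    by (rule assms(1), rule less_le_trans[OF assms(2)]) simp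
  then have "(\<lambda>n. 0) \<longlonglongrightarrow> moment (Suc j) (Suc l) a"
    using moment_difference_quotient[of a j l] assms by simp
  then show ?thesis by (simp add: LIMSEQ_const_iff)
qed

text \<open>The product rule applied to an identity in \<open>a\<close>: differentiating the power
  lowers its exponent, and differentiating the moment raises both indices with a minus sign.\<close>

lemma moment_differentiated_relation:
  assumes rel: "\<And>a. a > 1/4 \<Longrightarrow> of_real ((a + 1/4) ^ p) * moment p 0 a + of_real ((a - 1/4) ^ p) * moment 0 p a = 0" and a: "a > 1/4"
  shows "of_real ((a + 1/4) ^ p) * moment (Suc p) 1 a + of_real ((a - 1/4) ^ p) * moment 1 (Suc p) a =
     of_real (real p * (a + 1/4) ^ (p - 1)) * moment p 0 a + of_real (real p * (a - 1/4) ^ (p - 1)) * moment 0 p a"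
proof -
  define h where "h n = 1 / real (Suc n)" for n
  have h0: "h \<longlonglongrightarrow> 0" unfolding h_def using LIMSEQ_inverse_real_of_nat by (simp add: divide_inverse)
  have hpos: "h n > 0" "real (Suc n) * h n = 1" for n by (simp_all add: h_def)
  \<comment> \<open>Continuity along \<open>a + h n\<close>: the increment is the step
    \<open>h n\<close> times a convergent difference quotient.\<close>
  have lim: "(\<lambda>n. moment j l (a + h n)) \<longlonglongrightarrow> moment j l a" for j l
  proof -
    have "(\<lambda>n. moment j l a - of_real (h n) * (of_nat (Suc n) * (moment j l a - moment j l (a + h n)))) \<longlonglongrightarrow>
       moment j l a - of_real 0 * moment (Suc j) (Suc l) a"
      unfolding h_def using a by (intro tendsto_intros moment_difference_quotient h0[unfolded h_def]) auto
    moreover have "of_real (h n) * (of_nat (Suc n) * x) = (x::complex)" for n x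
      by (simp add: h_def del: of_nat_Suc)
    ultimately show ?thesis by (simp del: of_nat_Suc)
  qed
  \<comment> \<open>Minus the difference quotient of \<open>(a + s) ^ p * moment j l a\<close>,
    split as in the product rule; it is used with \<open>s\<close> equal to \<open>1/4\<close> and
    \<open>-1/4\<close>.\<close>
  define X where "X s j l n = of_real ((a + s) ^ p) * (of_nat (Suc n) * (moment j l a - moment j l (a + h n)))
      - of_real (real (Suc n) * ((a + s + h n) ^ p - (a + s) ^ p)) * moment j l (a + h n)" for s j l n
  have X: "X s j l \<longlonglongrightarrow> of_real ((a + s) ^ p) * moment (Suc j) (Suc l) a - of_real (real p * (a + s) ^ (p - 1)) * moment j l a" for s j l
  proof -
    have "a > 0" using a by simp
    show ?thesis
      unfolding X_def
      by (rule tendsto_diff[OF tendsto_mult[OF tendsto_const moment_difference_quotient[OF \<open>a > 0\<close>, folded h_def]]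
            tendsto_mult[OF tendsto_of_real[OF power_difference_quotient[folded h_def]] lim]])
  qed
  have X_eq: "X s j l n = of_nat (Suc n) * (of_real ((a + s) ^ p) * moment j l a - of_real ((a + h n + s) ^ p) * moment j l (a + h n))" for s j l n
    by (simp add: X_def algebra_simps)
  have "X (1/4) p 0 n + X (-1/4) 0 p n = 0" for n
  proof -
    have "X (1/4) p 0 n + X (-1/4) 0 p n = of_nat (Suc n) *
      ((of_real ((a + 1/4) ^ p) * moment p 0 a + of_real ((a - 1/4) ^ p) * moment 0 p a) -
       (of_real ((a + h n + 1/4) ^ p) * moment p 0 (a + h n) + of_real ((a + h n - 1/4) ^ p) * moment 0 p (a + h n)))"
      unfolding X_eq by (simp add: algebra_simps)
    also have "\<dots> = 0" using rel[OF a] rel[of "a + h n"] a hpos(1)[of n] by simp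
    finally show ?thesis .
  qed
  moreover have "(\<lambda>n. X (1/4) p 0 n + X (-1/4) 0 p n) \<longlonglongrightarrow>
    (of_real ((a + 1/4) ^ p) * moment (Suc p) (Suc 0) a - of_real (real p * (a + 1/4) ^ (p - 1)) * moment p 0 a) +
    (of_real ((a + -1/4) ^ p) * moment (Suc 0) (Suc p) a - of_real (real p * (a + -1/4) ^ (p - 1)) * moment 0 p a)"
    by (intro tendsto_add X)
  ultimately have "(of_real ((a + 1/4) ^ p) * moment (Suc p) (Suc 0) a - of_real (real p * (a + 1/4) ^ (p - 1)) * moment p 0 a) +
    (of_real ((a + -1/4) ^ p) * moment (Suc 0) (Suc p) a - of_real (real p * (a + -1/4) ^ (p - 1)) * moment 0 p a) = 0"
    by (simp add: LIMSEQ_const_iff del: of_real_mult of_real_power of_real_add)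
  then show ?thesis by (simp add: algebra_simps)
qed

text \<open>In the sum of order \<open>n\<close>, the moment at \<open>l\<close> has index
  difference \<open>|n - 2 * l|\<close>. By \<open>IH\<close> the orders \<open>p\<close> and
  \<open>p + 2\<close> leave at most two terms of each sum considered, all with difference exactly
  \<open>p\<close>.\<close>

lemma moment_extreme_eq_0:
  assumes IH: "\<And>j l a. a > 1/4 \<Longrightarrow> j < l + p \<Longrightarrow> l < j + p \<Longrightarrow> moment j l a = 0" and a: "a > 1/4"
  shows "moment p 0 a = 0 \<and> moment 0 p a = 0"
proof -
  \<comment> \<open>\<open>small\<close> says \<open>|n - 2 * l| < p\<close>, written without
    truncated subtraction.\<close>
  have collapse: "(\<Sum>l | l \<le> n \<and> Q l. term_at n b l) = (\<Sum>l\<in>S. term_at n b l)"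
    if b: "b > 1/4" and S: "S \<subseteq> {l. l \<le> n \<and> Q l}"
      and small: "\<And>l. l \<le> n \<Longrightarrow> Q l \<Longrightarrow> l \<notin> S \<Longrightarrow> n < 2 * l + p \<and> 2 * l < n + p" for n b Q S
  proof (rule sum.mono_neutral_right)
    show "\<forall>l\<in>{l. l \<le> n \<and> Q l} - S. term_at n b l = 0"
    proof
      fix l assume "l \<in> {l. l \<le> n \<and> Q l} - S"
      then have "l \<le> n" "n < 2 * l + p" "2 * l < n + p" using small by auto
      then have "moment (n - l) l b = 0" by (intro IH[OF b]) linarith+
      then show "term_at n b l = 0" by (simp add: term_at_def)
    qed
  qed (use S in auto)
  have c: "b + 1/4 \<noteq> 0" "b - 1/4 \<noteq> 0" if "b > 1/4" for b :: real using that by auto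
  consider "p = 0" | "odd p" | "even p" "p \<ge> 2" by (metis dvd_refl less_2_cases not_less odd_one One_nat_def)
  then show ?thesis
  proof cases
    case 1
    have "{l. l \<le> (0::nat) \<and> even l} = {0}" by auto
    then show ?thesis using parity_sum_eq_0(1)[OF a, of 0] 1 by (simp add: term_at_def)
  next
    case 2
    \<comment> \<open>For odd \<open>p\<close> the surviving indices 0 and \<open>p\<close> have
      opposite parity, so each is alone in its sum.\<close>
    have "(\<Sum>l | l \<le> p \<and> even l. term_at p a l) = (\<Sum>l\<in>{0}. term_at p a l)"
    proof (rule collapse[OF a])
      fix l assume "l \<le> p" "even l" "l \<notin> {0}"
      moreover from this have "l \<noteq> p" using 2 by auto
      ultimately show "p < 2 * l + p \<and> 2 * l < p + p" by simp
    qed simp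
    moreover have "(\<Sum>l | l \<le> p \<and> odd l. term_at p a l) = (\<Sum>l\<in>{p}. term_at p a l)"
    proof (rule collapse[OF a])
      fix l assume "l \<le> p" "odd l" "l \<notin> {p}"
      moreover from this have "l \<noteq> 0" by (intro notI) simp
      ultimately show "p < 2 * l + p \<and> 2 * l < p + p" by simp
    qed (use 2 in simp)
    ultimately show ?thesis using parity_sum_eq_0[OF a, of p] c[OF a]
      by (auto simp: term_at_def simp flip: of_real_add of_real_diff)
  next
    case 3
    have rel: "of_real ((b + 1/4) ^ p) * moment p 0 b + of_real ((b - 1/4) ^ p) * moment 0 p b = 0" if b: "b > 1/4" for b
    proof -
      \<comment> \<open>Both surviving indices are even, so order \<open>p\<close> yields only one
        relation between the two moments.\<close>
      have "(\<Sum>l | l \<le> p \<and> even l. term_at p b l) = (\<Sum>l\<in>{0, p}. term_at p b l)"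
        using 3 by (intro collapse[OF b]) auto
      then show ?thesis using parity_sum_eq_0(1)[OF b, of p] 3 by (simp add: term_at_def)
    qed
    \<comment> \<open>The indices 0 and \<open>p + 2\<close>, with difference \<open>p + 2\<close>,
      are even and thus absent; 1 and \<open>p + 1\<close> give difference \<open>p\<close>.\<close>
    have "(\<Sum>l | l \<le> p + 2 \<and> odd l. term_at (p + 2) a l) = (\<Sum>l\<in>{1, p + 1}. term_at (p + 2) a l)"
    proof (rule collapse[OF a])
      fix l assume l: "l \<le> p + 2" "odd l" "l \<notin> {1, p + 1}"
      then have "l \<noteq> 0" "l \<noteq> p + 2" using 3 by (metis even_zero, auto)
      then show "p + 2 < 2 * l + p \<and> 2 * l < p + 2 + p" using l by simp
    qed (use 3 in simp)
    then have "term_at (p + 2) a 1 + term_at (p + 2) a (p + 1) = 0"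
      using parity_sum_eq_0(2)[OF a, of "p + 2"] 3 by simp
    moreover define C D where "C = complex_of_real (a + 1/4)" and "D = complex_of_real (a - 1/4)"
    moreover have "(p + 2) choose (p + 1) = p + 2"
      using binomial_symmetric[of "p + 1" "p + 2"] by simp
    \<comment> \<open>Both binomial coefficients equal \<open>p + 2\<close>, and
      \<open>C * D\<close> is common to both terms.\<close>
    ultimately have "of_nat (p + 2) * (C * D * (C ^ p * moment (Suc p) 1 a + D ^ p * moment 1 (Suc p) a)) = 0"
      by (simp add: term_at_def mult_ac distrib_left del: of_real_add of_real_diff of_nat_Suc of_nat_add)
    moreover have CD: "C \<noteq> 0" "D \<noteq> 0" "C - D = 1/2"
      using c[OF a] by (auto simp: C_def D_def simp flip: of_real_diff simp del: of_real_add)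
    ultimately have "C ^ p * moment (Suc p) 1 a + D ^ p * moment 1 (Suc p) a = 0"
      by (metis mult_eq_0_iff of_nat_eq_0_iff add_is_0 zero_neq_numeral)
    then have "of_real ((a + 1/4) ^ p) * moment (Suc p) 1 a + of_real ((a - 1/4) ^ p) * moment 1 (Suc p) a = 0"
      by (simp only: C_def D_def of_real_power)
    then have "of_real (real p * (a + 1/4) ^ (p - 1)) * moment p 0 a + of_real (real p * (a - 1/4) ^ (p - 1)) * moment 0 p a = 0"
      using moment_differentiated_relation[OF rel a] by (metis (no_types))
    then have "of_real (real p) * (of_real ((a + 1/4) ^ (p - 1)) * moment p 0 a + of_real ((a - 1/4) ^ (p - 1)) * moment 0 p a) = 0"
      by (simp only: of_real_mult distrib_left mult.assoc)
    then have rel': "of_real ((a + 1/4) ^ (p - 1)) * moment p 0 a + of_real ((a - 1/4) ^ (p - 1)) * moment 0 p a = 0"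
      using 3 by (simp del: of_real_power of_real_add of_real_diff)
    obtain k where p: "p = Suc k" using 3 by (cases p) auto
    have e1: "C ^ k * C * moment p 0 a + D ^ k * D * moment 0 p a = 0"
      using rel[OF a] by (simp add: p C_def D_def mult.commute)
    have e2: "C ^ k * moment p 0 a + D ^ k * moment 0 p a = 0"
      using rel' by (simp add: p C_def D_def)
    \<comment> \<open>Eliminating \<open>moment 0 p a\<close> between \<open>e1\<close> and
      \<open>e2\<close> leaves the nonzero factor \<open>C - D = 1/2\<close>.\<close>
    have "C ^ k * (C - D) * moment p 0 a =
        (C ^ k * C * moment p 0 a + D ^ k * D * moment 0 p a) - D * (C ^ k * moment p 0 a + D ^ k * moment 0 p a)"
      by (simp add: algebra_simps)
    then have "C ^ k * (C - D) * moment p 0 a = 0" unfolding e1 e2 by simp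
    then have "moment p 0 a = 0" using CD by simp
    then show ?thesis using e2 CD by simp
  qed
qed

text \<open>Strong induction on the index difference \<open>p\<close>, then induction along each
  diagonal by differentiation. The claim is carried for all \<open>a > 1/4\<close> at once because
  it gets differentiated in \<open>a\<close>.\<close>

lemma moment_eq_0:
  assumes "a > 1/4"
  shows "moment j l a = 0"
proof -
  have "\<forall>a>1/4. \<forall>i. moment (p + i) i a = 0 \<and> moment i (p + i) a = 0" for p
  proof (induction p rule: less_induct)
    case (less p)
    have "moment j l a = 0" if "a > 1/4" "j < l + p" "l < j + p" for j l a
    proof (cases "l \<le> j")
      case True
      have "j - l < p" using that True by linarith
      from less[OF this] that have "moment (j - l + l) l a = 0" by blast
      then show ?thesis using True by simp
    next
      case False
      have "l - j < p" using that False by linarith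
      from less[OF this] that have "moment j (l - j + j) a = 0" by blast
      then show ?thesis using False by simp
    qed
    then have base: "moment p 0 a = 0 \<and> moment 0 p a = 0" if "a > 1/4" for a
      using moment_extreme_eq_0[of p a] that by auto
    have "\<forall>a>1/4. moment (p + i) i a = 0 \<and> moment i (p + i) a = 0" for i
    proof (induction i)
      case (Suc i)
      then show ?case by (auto intro!: moment_Suc_Suc_eq_0)
    qed (use base in simp)
    then show ?case by blast
  qed
  note * = this
  show ?thesis
  proof (cases "l \<le> j")
    case True
    have "moment (j - l + l) l a = 0" using * assms by blast
    then show ?thesis using True by simp
  next
    case False
    have "moment j (l - j + j) a = 0" using * assms by blast
    then show ?thesis using False by simp
  qed
qed

end

subsection \<open>Recovery from the moments\<close>

text \<open>With \<open>y = exp (- \<kappa> (dist z w)\<^sup>2)\<close> these powers are finite combinations of Gaussians in \<open>w\<close>, bounded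
  by 1, that converge pointwise to the indicator of the complement of the ball \<open>y \<ge> 1/2\<close>. The factor
  \<open>n\<close> in the exponent makes the limit 0 on the sphere \<open>y = 1/2\<close> as well.\<close>

lemma tendsto_steep_power_0:
  fixes y :: real
  assumes "1/2 \<le> y" "y \<le> 1"
  shows "(\<lambda>n. (1 - y ^ n) ^ (n * 2 ^ n)) \<longlonglongrightarrow> 0"
proof (rule tendsto_sandwich[OF _ _ tendsto_const])
  have y: "0 \<le> y ^ n" "y ^ n \<le> 1" for n using assms by (auto intro: power_le_one)
  show "\<forall>\<^sub>F n in sequentially. 0 \<le> (1 - y ^ n) ^ (n * 2 ^ n)"
    using y by simp
  show "\<forall>\<^sub>F n in sequentially. (1 - y ^ n) ^ (n * 2 ^ n) \<le> exp (- real n)"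
  proof (rule always_eventually, rule allI)
    fix n
    have "1 - y ^ n \<le> exp (- (y ^ n))" using exp_ge_add_one_self[of "- (y ^ n)"] by simp
    then have "(1 - y ^ n) ^ (n * 2 ^ n) \<le> exp (- (y ^ n)) ^ (n * 2 ^ n)"
      using y by (intro power_mono) auto
    also have "\<dots> = exp (- (real n * (2 * y) ^ n))"
      by (simp add: power_mult_distrib mult_ac flip: exp_of_nat_mult)
    also have "\<dots> \<le> exp (- real n)"
      using assms one_le_power[of "2 * y" n] by (simp add: mult_le_cancel_left1)
    finally show "(1 - y ^ n) ^ (n * 2 ^ n) \<le> exp (- real n)" .
  qed
  show "(\<lambda>n. exp (- real n)) \<longlonglongrightarrow> 0" by real_asymp
qed

text \<open>Bernoulli's inequality gives the lower bound \<open>1 - n * (2 * y) ^ n\<close>, and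
  geometric decay beats the factor \<open>n\<close>.\<close>

lemma tendsto_steep_power_1:
  fixes y :: real
  assumes "0 \<le> y" "y < 1/2"
  shows "(\<lambda>n. (1 - y ^ n) ^ (n * 2 ^ n)) \<longlonglongrightarrow> 1"
proof (rule tendsto_sandwich[OF _ _ _ tendsto_const])
  have y: "0 \<le> y ^ n" "y ^ n \<le> 1" for n using assms by (auto intro: power_le_one)
  show "\<forall>\<^sub>F n in sequentially. (1 - y ^ n) ^ (n * 2 ^ n) \<le> 1"
    using y by (auto intro!: always_eventually power_le_one)
  show "\<forall>\<^sub>F n in sequentially. 1 - real n * (2 * y) ^ n \<le> (1 - y ^ n) ^ (n * 2 ^ n)"
  proof (rule always_eventually, rule allI)
    fix n
    show "1 - real n * (2 * y) ^ n \<le> (1 - y ^ n) ^ (n * 2 ^ n)"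
      using Bernoulli_inequality[of "- (y ^ n)" "n * 2 ^ n"] y[of n] by (simp add: power_mult_distrib mult_ac)
  qed
  have "(\<lambda>n. real n * (2 * y) ^ n) \<longlonglongrightarrow> 0"
    using assms by (intro powser_times_n_limit_0) auto
  then show "(\<lambda>n. 1 - real n * (2 * y) ^ n) \<longlonglongrightarrow> 1"
    using tendsto_diff[OF tendsto_const[of 1]] by fastforce
qed

section \<open>A pi-system generating the Borel sets\<close>

text \<open>Pairs hold centre and radius. The steep powers converge to indicators of complements of
  closed balls; finite intersections give a pi-system, and the empty index set gives the whole
  space.\<close>

definition cocball_inters :: "'a::metric_space set set" where
  "cocball_inters = {\<Inter>p\<in>S. - cball (fst p) (snd p) | S. finite S \<and> (\<forall>p\<in>S. snd p > 0)}"

lemma Int_stable_cocball_inters: "Int_stable cocball_inters"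
proof (rule Int_stableI)
  fix A B :: "'a set" assume "A \<in> cocball_inters" "B \<in> cocball_inters"
  then obtain S T where "finite S" "\<forall>p\<in>S. snd p > 0" "A = (\<Inter>p\<in>S. - cball (fst p) (snd p))"
    "finite T" "\<forall>p\<in>T. snd p > 0" "B = (\<Inter>p\<in>T. - cball (fst p) (snd p))"
    unfolding cocball_inters_def by auto
  then show "A \<inter> B \<in> cocball_inters"
    unfolding cocball_inters_def by (intro CollectI exI[of _ "S \<union> T"]) auto
qed

text \<open>An open set is covered by open balls whose closed counterparts still lie in it. By
  Lindelof countably many suffice, and the corresponding closed balls have the same union.\<close>

lemma sets_borel_eq_cocball_inters:
  "sets borel = sigma_sets UNIV (cocball_inters :: 'a::{metric_space, second_countable_topology} set set)"
proof -
  have "borel = sigma UNIV (cocball_inters :: 'a set set)"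
    unfolding borel_def
  proof (rule sigma_eqI)
    show "sigma_sets UNIV {S. open S} = sigma_sets UNIV (cocball_inters :: 'a set set)"
    proof (rule sigma_sets_eqI)
      fix U :: "'a set" assume "U \<in> {S. open S}"
      then have U: "open U" by simp
      define T where "T = {p. snd p > 0 \<and> cball (fst p) (snd p) \<subseteq> U}"
      have "\<Union>((\<lambda>p. ball (fst p) (snd p)) ` T) = U"
      proof
        show "U \<subseteq> \<Union>((\<lambda>p. ball (fst p) (snd p)) ` T)"
        proof
          fix x assume "x \<in> U"
          then obtain e where "e > 0" "cball x e \<subseteq> U" using U open_contains_cball by blast
          then have "(x, e) \<in> T" "x \<in> ball (fst (x, e)) (snd (x, e))" by (auto simp: T_def)
          then show "x \<in> \<Union>((\<lambda>p. ball (fst p) (snd p)) ` T)" by blast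
        qed
      qed (auto simp: T_def)
      moreover obtain \<F> where \<F>: "\<F> \<subseteq> (\<lambda>p. ball (fst p) (snd p)) ` T" "countable \<F>" "\<Union>\<F> = \<Union>((\<lambda>p. ball (fst p) (snd p)) ` T)"
      proof (rule Lindelof)
        show "open B" if "B \<in> (\<lambda>p. ball (fst p) (snd p)) ` T" for B using that by (elim imageE) simp
      qed
      moreover obtain T' where T': "countable T'" "T' \<subseteq> T" "\<F> = (\<lambda>p. ball (fst p) (snd p)) ` T'"
        using countable_subset_image[THEN iffD1, OF conjI, OF \<F>(2,1)] by (elim exE conjE)
      ultimately have "U = (\<Union>p\<in>T'. ball (fst p) (snd p))"
        by (simp only:)
      also have "\<dots> \<subseteq> (\<Union>p\<in>T'. cball (fst p) (snd p))"
        using ball_subset_cball by (intro UN_mono) auto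
      finally have "U = (\<Union>p\<in>T'. cball (fst p) (snd p))"
        using T'(2) by (intro equalityI UN_least) (auto simp only: T_def mem_Collect_eq)
      also have "\<dots> \<in> sigma_sets UNIV cocball_inters"
      proof (rule sigma_sets_UNION)
        show "countable ((\<lambda>p. cball (fst p) (snd p)) ` T')" using T' by simp
        fix B assume "B \<in> (\<lambda>p. cball (fst p) (snd p)) ` T'"
        then obtain p where p: "p \<in> T'" "B = cball (fst p) (snd p)" by auto
        then have "- cball (fst p) (snd p) \<in> cocball_inters"
          using T'(2) unfolding cocball_inters_def T_def by (intro CollectI exI[of _ "{p}"]) auto
        then have "UNIV - (- cball (fst p) (snd p)) \<in> sigma_sets UNIV cocball_inters"
          by (intro sigma_sets.Compl sigma_sets.Basic)
        then show "B \<in> sigma_sets UNIV cocball_inters" using p by (simp add: Diff_Compl)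
      qed
      finally show "U \<in> sigma_sets UNIV cocball_inters" .
    next
      fix A :: "'a set" assume "A \<in> cocball_inters"
      then have "open A" unfolding cocball_inters_def by (auto intro!: open_INT)
      then show "A \<in> sigma_sets UNIV {S. open S}" by (simp add: sigma_sets.Basic)
    qed
  qed auto
  then have "sets borel = sets (sigma UNIV (cocball_inters :: 'a set set))" by (rule arg_cong)
  also have "\<dots> = sigma_sets UNIV cocball_inters" by (rule sets_measure_of) simp
  finally show ?thesis .
qed

section \<open>Test functions against which \<open>g\<close> integrates to zero\<close>

context cross_vanishing
begin

text \<open>For \<open>a > 0\<close>, up to a constant factor, the Gaussian centred at
  \<open>\<zeta> / (2 * a)\<close>.\<close>

definition weight :: "real \<Rightarrow> complex \<Rightarrow> complex \<Rightarrow> real" where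
  "weight a \<zeta> w = exp (Re (\<zeta> * cnj w) - a * (norm w)\<^sup>2)"

lemma measurable_weight [measurable]: "weight a \<zeta> \<in> borel_measurable borel"
  unfolding weight_def by (intro borel_measurable_continuous_onI continuous_intros)

text \<open>\<open>Re (\<zeta> * cnj w)\<close> is linear in \<open>w\<close> and
  \<open>cnj w\<close>, so the exponential series integrates termwise to combinations of
  moments.\<close>

lemma weight_integral_eq_0:
  assumes a: "a > 1/4"
  shows "(LINT w|lborel. g w * of_real (weight a \<zeta> w)) = 0"
proof -
  define P where "P w = cnj \<zeta> / 2 * w + \<zeta> / 2 * cnj w" for w
  have P: "P w = of_real (Re (\<zeta> * cnj w))" for w by (simp add: P_def complex_eq_iff field_simps)
  have "(\<lambda>n. (LINT w|lborel. g w * P w ^ n * gauss a w) / fact n * 1 ^ n) sums (LINT w|lborel. g w * exp (1 * P w) * gauss a w)"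
  proof (rule exp_integral_sums)
    show "norm (P w) \<le> norm \<zeta> * norm w" for w
      unfolding P norm_of_real by (rule abs_Re_le_cmod[THEN order_trans]) (simp add: norm_mult)
    show "P \<in> borel_measurable borel" unfolding P_def by measurable
  qed (use a in auto)
  moreover have "(LINT w|lborel. g w * P w ^ n * gauss a w) = 0" for n
    unfolding P_def using a moment_eq_0[OF a] by (subst linear_power_integral) auto
  ultimately have "(LINT w|lborel. g w * exp (P w) * gauss a w) = 0"
    by (simp add: sums_iff)
  moreover have "exp (P w) * gauss a w = of_real (weight a \<zeta> w)" for w
    unfolding P exp_of_real weight_def of_real_mult[symmetric] exp_add[symmetric] by simp
  ultimately show ?thesis by (simp add: mult.assoc)
qed

text \<open>Demanding all \<open>a\<close> and \<open>\<zeta>\<close> makes the property stable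
  under multiplication by Gaussian bumps; the bound 1 makes it stable under pointwise
  limits.\<close>

definition annihilated :: "(complex \<Rightarrow> real) \<Rightarrow> bool" where
  "annihilated \<phi> \<longleftrightarrow> \<phi> \<in> borel_measurable borel \<and> (\<forall>w. \<bar>\<phi> w\<bar> \<le> 1) \<and>
     (\<forall>a>1/4. \<forall>\<zeta>. (LINT w|lborel. g w * of_real (weight a \<zeta> w * \<phi> w)) = 0)"

lemma weight_integrable:
  assumes [measurable]: "\<phi> \<in> borel_measurable borel" and \<phi>: "\<And>w. \<bar>\<phi> w\<bar> \<le> 1" and "a > 1/4"
  shows "integrable lborel (\<lambda>w. g w * of_real (weight a \<zeta> w * \<phi> w))"
proof -
  have "integrable lborel (\<lambda>w. g w * of_real (exp (Re (\<zeta> * cnj w)) * \<phi> w) * gauss a w)"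
  proof (rule exp_type_integrable)
    show "norm (complex_of_real (exp (Re (\<zeta> * cnj w)) * \<phi> w)) \<le> 1 * exp (norm \<zeta> * norm w)" for w
    proof -
      have "Re (\<zeta> * cnj w) \<le> norm \<zeta> * norm w"
        by (rule complex_Re_le_cmod[THEN order_trans]) (simp add: norm_mult)
      then have "exp (Re (\<zeta> * cnj w)) * \<bar>\<phi> w\<bar> \<le> exp (norm \<zeta> * norm w) * 1"
        by (intro mult_mono \<phi>) auto
      then show ?thesis by (simp only: norm_of_real abs_mult abs_exp_cancel mult_1 mult_1_right)
    qed
    show "(\<lambda>w. complex_of_real (exp (Re (\<zeta> * cnj w)) * \<phi> w)) \<in> borel_measurable borel" by measurable
  qed (use assms in auto)
  then show ?thesis
    by (simp add: weight_def diff_conv_add_uminus exp_add mult_ac del: add_uminus_conv_diff)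
qed

lemma annihilated_integrable:
  "annihilated \<phi> \<Longrightarrow> a > 1/4 \<Longrightarrow> integrable lborel (\<lambda>w. g w * of_real (weight a \<zeta> w * \<phi> w))"
  unfolding annihilated_def by (intro weight_integrable) auto

lemma annihilated_1: "annihilated (\<lambda>_. 1)"
  using weight_integral_eq_0 by (simp add: annihilated_def)

lemma annihilated_diff:
  assumes "annihilated \<phi>" "annihilated \<psi>" and "\<And>w. \<bar>\<phi> w - \<psi> w\<bar> \<le> 1"
  shows "annihilated (\<lambda>w. \<phi> w - \<psi> w)"
  unfolding annihilated_def
proof (intro conjI allI impI)
  fix a \<zeta> assume a: "a > (1/4::real)"
  have "(LINT w|lborel. g w * of_real (weight a \<zeta> w * (\<phi> w - \<psi> w))) =
      (LINT w|lborel. g w * of_real (weight a \<zeta> w * \<phi> w) - g w * of_real (weight a \<zeta> w * \<psi> w))"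
    by (simp add: algebra_simps)
  also have "\<dots> = 0"
    using assms a by (subst Bochner_Integration.integral_diff[OF annihilated_integrable annihilated_integrable]) (auto simp: annihilated_def)
  finally show "(LINT w|lborel. g w * of_real (weight a \<zeta> w * (\<phi> w - \<psi> w))) = 0" .
qed (use assms in \<open>auto simp: annihilated_def\<close>)

lemma annihilated_limit:
  assumes \<phi>: "\<And>n. annihilated (\<phi> n)" and lim: "\<And>w. (\<lambda>n. \<phi> n w) \<longlonglongrightarrow> \<psi> w"
  shows "annihilated \<psi>"
  unfolding annihilated_def
proof (intro conjI allI impI)
  have [measurable]: "\<phi> n \<in> borel_measurable borel" and b: "\<bar>\<phi> n w\<bar> \<le> 1" for n w
    using \<phi>[of n] by (auto simp: annihilated_def)
  show meas: "\<psi> \<in> borel_measurable borel"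
    by (rule borel_measurable_LIMSEQ_real[OF lim]) simp
  fix w show "\<bar>\<psi> w\<bar> \<le> 1"
    by (rule tendsto_upperbound[OF tendsto_rabs[OF lim]]) (auto simp: b)
next
  fix a \<zeta> assume a: "a > (1/4::real)"
  have [measurable]: "\<phi> n \<in> borel_measurable borel" and b: "\<bar>\<phi> n w\<bar> \<le> 1" for n w
    using \<phi>[of n] by (auto simp: annihilated_def)
  have [measurable]: "\<psi> \<in> borel_measurable borel"
    by (rule borel_measurable_LIMSEQ_real[OF lim]) simp
  have "(\<lambda>n. LINT w|lborel. g w * of_real (weight a \<zeta> w * \<phi> n w)) \<longlonglongrightarrow> (LINT w|lborel. g w * of_real (weight a \<zeta> w * \<psi> w))"
  proof (rule integral_dominated_convergence[where w="\<lambda>w. norm (g w * of_real (weight a \<zeta> w * 1))"])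
    show "integrable lborel (\<lambda>w. norm (g w * complex_of_real (weight a \<zeta> w * 1)))"
      using annihilated_integrable[OF annihilated_1 a] by (rule integrable_norm)
    show "AE w in lborel. norm (g w * of_real (weight a \<zeta> w * \<phi> n w)) \<le> norm (g w * complex_of_real (weight a \<zeta> w * 1))" for n
      by (intro AE_I2) (auto simp: norm_mult abs_mult b intro!: mult_left_mono mult_left_le)
    show "AE w in lborel. (\<lambda>n. g w * of_real (weight a \<zeta> w * \<phi> n w)) \<longlonglongrightarrow> g w * of_real (weight a \<zeta> w * \<psi> w)"
      by (intro AE_I2 tendsto_intros lim)
  qed measurable
  moreover have "(LINT w|lborel. g w * of_real (weight a \<zeta> w * \<phi> n w)) = 0" for n
    using \<phi>[of n] a by (auto simp: annihilated_def)
  ultimately show "(LINT w|lborel. g w * of_real (weight a \<zeta> w * \<psi> w)) = 0"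
    by (simp add: LIMSEQ_const_iff)
qed

lemma annihilated_mult_bump:
  assumes \<phi>: "annihilated \<phi>" and \<kappa>: "\<kappa> \<ge> 0"
  shows "annihilated (\<lambda>w. \<phi> w * exp (- (\<kappa> * (dist z w)\<^sup>2)))"
  unfolding annihilated_def
proof (intro conjI allI impI)
  have [measurable]: "\<phi> \<in> borel_measurable borel" and b: "\<bar>\<phi> w\<bar> \<le> 1" for w
    using \<phi> by (auto simp: annihilated_def)
  show "(\<lambda>w. \<phi> w * exp (- (\<kappa> * (dist z w)\<^sup>2))) \<in> borel_measurable borel" by measurable
  fix w show "\<bar>\<phi> w * exp (- (\<kappa> * (dist z w)\<^sup>2))\<bar> \<le> 1"
    using b[of w] \<kappa> by (auto simp: abs_mult intro!: mult_le_one)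
next
  fix a \<zeta> assume a: "a > (1/4::real)"
  have w: "weight a \<zeta> w * exp (- (\<kappa> * (dist z w)\<^sup>2)) = exp (- (\<kappa> * (norm z)\<^sup>2)) * weight (a + \<kappa>) (\<zeta> + of_real (2 * \<kappa>) * z) w" for w
  proof -
    have d: "(dist z w)\<^sup>2 = (norm z)\<^sup>2 - 2 * Re (z * cnj w) + (norm w)\<^sup>2"
      unfolding dist_norm cmod_power2 by (simp add: power2_eq_square algebra_simps)
    show ?thesis
      unfolding weight_def d exp_add[symmetric] by (simp add: algebra_simps)
  qed
  have "(LINT w|lborel. g w * of_real (weight a \<zeta> w * (\<phi> w * exp (- (\<kappa> * (dist z w)\<^sup>2))))) =
     (LINT w|lborel. of_real (exp (- (\<kappa> * (norm z)\<^sup>2))) * (g w * of_real (weight (a + \<kappa>) (\<zeta> + of_real (2 * \<kappa>) * z) w * \<phi> w)))"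
  proof (intro Bochner_Integration.integral_cong refl)
    fix v
    have "weight a \<zeta> v * (\<phi> v * exp (- (\<kappa> * (dist z v)\<^sup>2))) = exp (- (\<kappa> * (norm z)\<^sup>2)) * (weight (a + \<kappa>) (\<zeta> + of_real (2 * \<kappa>) * z) v * \<phi> v)"
      using w[of v] by (simp add: mult_ac)
    then show "g v * of_real (weight a \<zeta> v * (\<phi> v * exp (- (\<kappa> * (dist z v)\<^sup>2)))) =
        of_real (exp (- (\<kappa> * (norm z)\<^sup>2))) * (g v * of_real (weight (a + \<kappa>) (\<zeta> + of_real (2 * \<kappa>) * z) v * \<phi> v))"
      by (simp only: of_real_mult mult_ac)
  qed
  also have "\<dots> = 0"
    using \<phi> a \<kappa> by (simp only: integral_mult_right_zero annihilated_def) simp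
  finally show "(LINT w|lborel. g w * of_real (weight a \<zeta> w * (\<phi> w * exp (- (\<kappa> * (dist z w)\<^sup>2))))) = 0" .
qed

text \<open>Each further factor \<open>1 - b\<close> is a difference
  \<open>\<psi> - \<psi> * b\<close>; as \<open>1 - b\<close> lies between 0 and 1, the bound
  survives.\<close>

lemma annihilated_mult_cobump_power:
  assumes \<phi>: "annihilated \<phi>" and \<kappa>: "\<kappa> \<ge> 0"
  shows "annihilated (\<lambda>w. \<phi> w * (1 - exp (- (\<kappa> * (dist z w)\<^sup>2))) ^ m)"
proof (induction m)
  case (Suc m)
  let ?b = "\<lambda>w. exp (- (\<kappa> * (dist z w)\<^sup>2))" and ?\<psi> = "\<lambda>w. \<phi> w * (1 - exp (- (\<kappa> * (dist z w)\<^sup>2))) ^ m"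
  have "annihilated (\<lambda>w. ?\<psi> w - ?\<psi> w * ?b w)"
  proof (rule annihilated_diff[OF Suc annihilated_mult_bump[OF Suc \<kappa>]])
    fix w
    have "\<bar>?\<psi> w\<bar> \<le> 1" using Suc by (auto simp: annihilated_def)
    moreover have "\<bar>1 - ?b w\<bar> \<le> 1" using \<kappa> by simp
    ultimately have "\<bar>?\<psi> w\<bar> * \<bar>1 - ?b w\<bar> \<le> 1" by (intro mult_le_one) auto
    then show "\<bar>?\<psi> w - ?\<psi> w * ?b w\<bar> \<le> 1" by (simp add: right_diff_distrib flip: abs_mult)
  qed
  moreover have "?\<psi> w - ?\<psi> w * ?b w = \<phi> w * (1 - ?b w) ^ Suc m" for w
    by (simp add: algebra_simps)
  ultimately show ?case by simp
qed (use \<phi> in simp)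

lemma annihilated_mult_cocball:
  assumes \<phi>: "annihilated \<phi>" and R: "R > 0"
  shows "annihilated (\<lambda>w. \<phi> w * indicator (- cball z R) w)"
proof (rule annihilated_limit)
  \<comment> \<open>Makes the bump equal \<open>1/2\<close> exactly on the sphere of radius
    \<open>R\<close>, the threshold of the steep powers.\<close>
  define \<kappa> where "\<kappa> = ln 2 / R\<^sup>2"
  have \<kappa>: "\<kappa> > 0" using R by (simp add: \<kappa>_def)
  define y where "y w = exp (- (\<kappa> * (dist z w)\<^sup>2))" for w
  \<comment> \<open>The \<open>n\<close>-th power of the bump is again a bump, with
    \<open>real n * \<kappa>\<close> for \<open>\<kappa>\<close>.\<close>
  show "annihilated (\<lambda>w. \<phi> w * (1 - exp (- ((real n * \<kappa>) * (dist z w)\<^sup>2))) ^ (n * 2 ^ n))" for n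
    using \<phi> \<kappa> by (intro annihilated_mult_cobump_power) auto
  fix w
  have y: "0 \<le> y w" "y w \<le> 1" using \<kappa> by (auto simp: y_def)
  have y_half: "y w < 1/2 \<longleftrightarrow> R < dist z w"
  proof -
    have "y w < 1/2 \<longleftrightarrow> exp (- (\<kappa> * (dist z w)\<^sup>2)) < exp (- ln 2)" by (simp add: y_def exp_minus)
    also have "\<dots> \<longleftrightarrow> ln 2 < \<kappa> * (dist z w)\<^sup>2" unfolding exp_less_cancel_iff by simp
    also have "\<dots> \<longleftrightarrow> R\<^sup>2 < (dist z w)\<^sup>2" using R by (simp add: \<kappa>_def field_simps)
    also have "\<dots> \<longleftrightarrow> R < dist z w" using R by (metis power2_less_imp_less power_strict_mono zero_le_dist less_imp_le pos2)
    finally show ?thesis .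
  qed
  have "(\<lambda>n. (1 - y w ^ n) ^ (n * 2 ^ n)) \<longlonglongrightarrow> indicator (- cball z R) w"
    using tendsto_steep_power_0[of "y w"] tendsto_steep_power_1[of "y w"] y y_half
    by (cases "R < dist z w") (auto simp: indicator_def)
  moreover have "y w ^ n = exp (- ((real n * \<kappa>) * (dist z w)\<^sup>2))" for n
    by (simp add: y_def mult.assoc flip: exp_of_nat_mult)
  ultimately show "(\<lambda>n. \<phi> w * (1 - exp (- ((real n * \<kappa>) * (dist z w)\<^sup>2))) ^ (n * 2 ^ n)) \<longlonglongrightarrow> \<phi> w * indicator (- cball z R) w"
    by (intro tendsto_mult_left) simp
qed

lemma annihilated_cocball_inters:
  assumes "A \<in> cocball_inters"
  shows "annihilated (indicator A)"
proof -
  obtain S where S: "finite S" "\<forall>p\<in>S. snd p > 0" "A = (\<Inter>p\<in>S. - cball (fst p) (snd p))"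
    using assms by (auto simp: cocball_inters_def)
  have "annihilated (indicator (\<Inter>p\<in>S. - cball (fst p) (snd p)))"
    using S(1,2)
  proof (induction S)
    case empty
    then show ?case using annihilated_1 by (simp add: indicator_def)
  next
    case (insert p S)
    then have "annihilated (\<lambda>w. indicator (\<Inter>p\<in>S. - cball (fst p) (snd p)) w * indicator (- cball (fst p) (snd p)) w)"
      by (intro annihilated_mult_cocball) auto
    then show ?case by (simp add: Int_commute flip: indicator_inter_arith)
  qed
  then show ?thesis using S by simp
qed

text \<open>Dynkin's pi-lambda argument: complements come from differences, countable disjoint
  unions from finite ones by a limit.\<close>

lemma annihilated_borel:
  assumes "A \<in> sets borel"
  shows "annihilated (indicator A)"
proof -
  have "cocball_inters \<subseteq> Pow (UNIV :: complex set)" "A \<in> sigma_sets UNIV cocball_inters"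
    using assms by (simp_all add: sets_borel_eq_cocball_inters)
  with Int_stable_cocball_inters show ?thesis
  proof (induction rule: sigma_sets_induct_disjoint)
    case (basic A)
    then show ?case by (rule annihilated_cocball_inters)
  next
    case empty
    then show ?case by (simp add: annihilated_def)
  next
    case (compl A)
    have "annihilated (\<lambda>w. 1 - indicator A w)"
      by (rule annihilated_diff[OF annihilated_1 compl(2)]) (simp add: indicator_def)
    moreover have "(\<lambda>w. 1 - indicator A w) = (indicator (UNIV - A) :: complex \<Rightarrow> real)"
      by (auto simp: indicator_def)
    ultimately show ?case by simp
  next
    case (union A)
    have 0: "annihilated (\<lambda>w. 0)" by (simp add: annihilated_def)
    have "annihilated (indicator (\<Union>i<n. A i))" for n
    proof (induction n)
      case (Suc n)
      have "A i \<inter> A n = {}" if "i < n" for i using disjoint_family_onD[OF union(1)] that by simp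
      then have disj: "(\<Union>i<n. A i) \<inter> A n = {}" by blast
      \<comment> \<open>A sum is formed as \<open>\<phi> - (0 - \<psi>)\<close> by closure under
        differences; disjointness keeps it bounded by 1.\<close>
      have "annihilated (\<lambda>w. 0 - indicator (A n) w)"
        by (rule annihilated_diff[OF 0 union(3)]) (simp add: indicator_def)
      from Suc this have "annihilated (\<lambda>w. indicator (\<Union>i<n. A i) w - (0 - indicator (A n) w))"
      proof (rule annihilated_diff)
        show "\<bar>indicator (\<Union>i<n. A i) w - (0 - indicator (A n) w :: real)\<bar> \<le> 1" for w
          using disj by (cases "w \<in> A n"; cases "w \<in> (\<Union>i<n. A i)") (simp_all add: disjoint_iff)
      qed
      also have "(\<lambda>w. indicator (\<Union>i<n. A i) w - (0 - indicator (A n) w)) = (indicator (\<Union>i<Suc n. A i) :: complex \<Rightarrow> real)"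
        using disj by (auto simp: fun_eq_iff indicator_def lessThan_Suc)
      finally show ?case .
    qed (use 0 in \<open>simp add: indicator_def\<close>)
    then show ?case
      by (rule annihilated_limit) (rule LIMSEQ_indicator_UN)
  qed
qed

text \<open>For \<open>a = 1\<close> and \<open>\<zeta> = 0\<close> the weight is a plain Gaussian.
  Its product with \<open>g\<close> has zero integral over every Borel set, and the Gaussian has no
  zeros.\<close>

theorem vanishes_AE: "AE w in lborel. g w = 0"
proof -
  have "AE w in lborel. g w * gauss 1 w = 0"
  proof (rule sigma_finite_measure.density_zero[OF sigma_finite_lborel])
    show "integrable lborel (\<lambda>w. g w * gauss 1 w)"
      using moment_integrable[of 1 0 0] by simp
    fix A :: "complex set" assume "A \<in> sets lborel"
    then have "annihilated (indicator A)" by (intro annihilated_borel) simp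
    then have "\<forall>a>1/4. \<forall>\<zeta>. (LINT w|lborel. g w * of_real (weight a \<zeta> w * indicator A w)) = 0"
      by (simp add: annihilated_def)
    from this[rule_format, of 1 0] show "(LINT w:A|lborel. g w * gauss 1 w) = 0"
      by (simp add: set_lebesgue_integral_def weight_def scaleR_conv_of_real mult_ac)
  qed
  then show ?thesis by eventually_elim simp
qed

end

section \<open>Reduction of the Coxeter system to its two perpendicular axes\<close>

theorem mainTheorem3:
  fixes N :: nat and q :: real
  assumes "N \<ge> 2" and "even N" and "1 \<le> q" and "q \<le> 2"
  shows "injectivity_set (coxeter_system N) (Lq q)"
  unfolding injectivity_set_def
proof (intro ballI impI)
  fix f assume f: "f \<in> Lq q" and tm: "\<forall>r>0. \<forall>z\<in>coxeter_system N. twisted_mean f r z = 0"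
  then have [measurable]: "f \<in> borel_measurable lebesgue" by (simp add: Lq_def)
  then obtain g where g [measurable]: "g \<in> borel_measurable borel" and fg: "AE w in lborel. f w = g w"
    by (rule lebesgue_ex_borel_complex)
  have "integrable lebesgue (\<lambda>w. norm (f w) powr q) = integrable lebesgue (\<lambda>w. norm (g w) powr q)"
    using fg by (intro integrable_cong_AE AE_completion) (auto elim!: eventually_mono intro!: measurable_completion)
  then have "integrable lborel (\<lambda>w. norm (g w) powr q)"
    using f by (simp add: Lq_def integrable_completion)
  then interpret gauss_tempered g
    by unfold_locales (use g Lq_gaussian_integrable[OF g _ \<open>1 \<le> q\<close>] in auto)
  have lines: "of_real x * \<zeta> \<in> coxeter_system N" if "\<zeta> = 1 \<or> \<zeta> = \<i>" for x \<zeta>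
    using that
  proof
    assume "\<zeta> = 1"
    then show ?thesis
      using \<open>N \<ge> 2\<close> unfolding coxeter_system_def by (intro UN_I[of 0] CollectI exI[of _ x]) auto
  next
    assume "\<zeta> = \<i>"
    \<comment> \<open>The imaginary axis is the line of index \<open>N div 2\<close>; evenness of
      \<open>N\<close> makes its angle exactly \<open>pi / 2\<close>.\<close>
    moreover have "exp (\<i> * of_real (pi * real (N div 2) / real N)) = \<i>"
    proof -
      have "pi * real (N div 2) / real N = pi / 2" using assms by (simp add: real_of_nat_div)
      then show ?thesis by (simp only: cis_conv_exp[symmetric] cis_pi_half)
    qed
    ultimately show ?thesis
      using \<open>N \<ge> 2\<close> unfolding coxeter_system_def by (intro UN_I[of "N div 2"] CollectI exI[of _ x]) auto
  qed
  interpret cross_vanishing g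
  proof unfold_locales
    fix a x :: real and \<zeta> :: complex
    assume a: "a > 1/4" and \<zeta>: "\<zeta> = 1 \<or> \<zeta> = \<i>"
    define z where "z = of_real x * \<zeta>"
    \<comment> \<open>\<open>F\<close> is the twisted integrand at centre \<open>z\<close> with a
      Gaussian factor; \<open>h\<close> is its form after the substitution \<open>u = z - w\<close>,
      up to a constant.\<close>
    define L where "L w = of_real x * (of_real (a + 1/4) * cnj \<zeta> * w + of_real (a - 1/4) * \<zeta> * cnj w)" for w
    define h where "h w = g w * exp (L w) * gauss a w" for w
    define F where "F w = g (z - w) * exp (\<i> / 2 * of_real (Im (z * cnj w))) * exp (- of_real (a * (norm w)\<^sup>2))" for w
    have h: "integrable lborel h"
      unfolding h_def
    proof (rule exp_type_integrable)
      show "norm (exp (L w)) \<le> 1 * exp ((\<bar>x\<bar> * 2 * a) * norm w)" for w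
      proof -
        have "norm \<zeta> = 1" using \<zeta> by auto
        then have "norm (L w) \<le> \<bar>x\<bar> * ((a + 1/4) * norm w + (a - 1/4) * norm w)"
          unfolding L_def norm_mult norm_of_real using a
          by (intro mult_left_mono norm_triangle_ineq[THEN order_trans])
             (auto simp: norm_mult simp del: of_real_add of_real_diff)
        also have "\<dots> = (\<bar>x\<bar> * 2 * a) * norm w" by (simp add: algebra_simps)
        finally show ?thesis
          using complex_Re_le_cmod[of "L w"] by simp
      qed
      show "(\<lambda>w. exp (L w)) \<in> borel_measurable borel" unfolding L_def by measurable
    qed (use a in auto)
    have F_eq: "F w = of_real (exp (- (a * (norm z)\<^sup>2))) * h (z - w)" for w
    proof -
      define u where "u = z - w"
      have w: "w = z - u" by (simp add: u_def)
      have zu: "z * cnj u = of_real x * (\<zeta> * cnj u)" "cnj (z * cnj u) = of_real x * (cnj \<zeta> * u)"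
        by (simp_all add: z_def)
      \<comment> \<open>The first part will match the cross term of \<open>(norm (z - u))^2\<close>,
        the second the twist.\<close>
      have "L u = of_real a * (z * cnj u + cnj (z * cnj u)) - 1/4 * (z * cnj u - cnj (z * cnj u))"
        unfolding L_def zu by (simp add: algebra_simps)
      also have "\<dots> = of_real (2 * a * Re (z * cnj u)) - \<i> / 2 * of_real (Im (z * cnj u))"
        unfolding complex_add_cnj complex_diff_cnj by (simp add: field_simps)
      finally have L: "L u = of_real (2 * a * Re (z * cnj u)) - \<i> / 2 * of_real (Im (z * cnj u))" .
      \<comment> \<open>\<open>z * cnj z\<close> is real and drops out.\<close>
      have im: "Im (z * cnj w) = - Im (z * cnj u)" by (simp add: w algebra_simps)
      have "(norm w)\<^sup>2 = (norm z)\<^sup>2 - 2 * Re (z * cnj u) + (norm u)\<^sup>2"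
        unfolding w cmod_power2 by (simp add: power2_eq_square algebra_simps)
      then have nw: "a * (norm w)\<^sup>2 = a * (norm z)\<^sup>2 - 2 * a * Re (z * cnj u) + a * (norm u)\<^sup>2"
        by (simp only: distrib_left right_diff_distrib mult_ac)
      have "exp (\<i> / 2 * of_real (Im (z * cnj w))) * exp (- of_real (a * (norm w)\<^sup>2)) =
        of_real (exp (- (a * (norm z)\<^sup>2))) * (exp (L u) * gauss a u)"
        unfolding exp_of_real[symmetric] exp_add[symmetric] L im nw
        by (rule arg_cong[where f=exp])
           (simp only: of_real_minus of_real_add of_real_diff diff_conv_add_uminus minus_add_distrib
             minus_minus mult_minus_right add_ac)
      then show ?thesis by (simp add: F_def h_def u_def mult_ac)
    qed
    have h_reflect: "integrable lborel (\<lambda>w. h (z - w))" "(LINT w|lborel. h (z - w)) = (LINT w|lborel. h w)"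
    proof -
      have [measurable]: "h \<in> borel_measurable borel" using h by auto
      show "integrable lborel (\<lambda>w. h (z - w))"
        using h by (subst (asm) lborel_reflect[of z, symmetric]) (simp add: integrable_distr_eq)
      show "(LINT w|lborel. h (z - w)) = (LINT w|lborel. h w)"
        by (subst (2) lborel_reflect[of z, symmetric]) (simp add: integral_distr)
    qed
    have "(LINT w|lborel. F w) = 0"
      unfolding F_def
    proof (rule gaussian_integral_zero_of_twisted_means[OF g fg])
      show "twisted_mean f r z = 0" if "r > 0" for r
        using tm that lines[OF \<zeta>] by (simp add: z_def)
      show "integrable lborel (\<lambda>w. g (z - w) * exp (\<i> / 2 * of_real (Im (z * cnj w))) * exp (- of_real (a * (norm w)\<^sup>2)))"
        unfolding F_def[symmetric] F_eq by (intro integrable_mult_right h_reflect)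
    qed
    then have "(LINT w|lborel. h w) = 0"
      unfolding F_eq h_reflect(2)[symmetric] by simp
    then show "(LINT w|lborel. g w * exp (of_real x * (of_real (a + 1/4) * cnj \<zeta> * w + of_real (a - 1/4) * \<zeta> * cnj w)) * gauss a w) = 0"
      by (simp only: h_def L_def)
  qed
  have "AE w in lborel. f w = 0"
    using fg vanishes_AE by eventually_elim simp
  then show "AE w in lebesgue. f w = 0" by (rule AE_completion)
qed

end
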